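(* Let $G$ be a finite abelian group with $|G|>1$, and let $\Gamma\subset\operatorname{Aut}(G)$ be a subset such that $\{\mathrm{id}_G,-\mathrm{id}_G\}\subset\Gamma$. 1. If $\mathcal B_\Gamma(G)$ is seminormal, then $\exp(G)$ is a power of $2$. 2. $\mathcal B_\pm(G)$ is seminormal if and only if $\exp(G)\mid 4$. If this holds, then $\widehat{\mathcal B_\pm(G)}=\{S\in\mathcal F(G):\sigma(S)\in 2G\}$. 3. Let $\Gamma=\operatorname{Aut}(G)$. (a) $\mathcal B_\Gamma(G)$ is seminormal if and only if $G\cong C_{2^{t_1}}\oplus\dots\oplus C_{2^{t_r}}$ for some $r,t_1,\dots,t_r\in\mathbb N$ with $t_1<\dots<t_r$. (b) Suppose $G\cong C_{2^{t_1}}\oplus\dots\oplus C_{2^{t_r}}$, where $r,t_1,\dots,t_r\in\mathbb N$ and $t_1<\dots<t_r$. For $S=g_1\cdot\ldots\cdot g_\ell\in\mathcal F(G)$, with $g_1,\dots,g_\ell\in G$, set $\mathsf n(S)=|\{j\in[1,\ell]:\operatorname{ord}(g_j)=2^{t_r}\}|$. Then $\widehat{\mathcal B_\Gamma(G)}=\{S\in\mathcal F(G):\mathsf n(S)\text{ is even}\}$.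
   Context: $G$ is written additively; $C_n$ is a cyclic group of order $n$; $2G=\{2g:g\in G\}$; $\mathbb N$ denotes the positive integers. $\mathcal F(G)$ is the (multiplicative) free abelian monoid with basis $G$; for $S=g_1\cdot\ldots\cdot g_\ell\in\mathcal F(G)$, $\sigma(S)=g_1+\dots+g_\ell\in G$. For a set $\Gamma$ of endomorphisms, $\mathcal B_\Gamma(G)=\{g_1\cdot\ldots\cdot g_\ell\in\mathcal F(G):\ \ell\ge0,\ \sum_{i=1}^\ell\gamma_i(g_i)=0\text{ for some }\gamma_1,\dots,\gamma_\ell\in\Gamma\}$, and $\mathcal B_\pm(G)=\mathcal B_{\{\mathrm{id}_G,-\mathrm{id}_G\}}(G)$. For a commutative cancellative monoid $H$ with quotient group $\mathsf q(H)$, the seminormalization is $H'=\{x\in\mathsf q(H):\text{there is }N\in\mathbb N\text{ with }x^n\in H\text{ for all }n\ge N\}$, and $H$ is seminormal if $H=H'$. The complete integral closure is $\widehat H=\{x\in\mathsf q(H):\text{there is }c\in H\text{ with }cx^n\in H\text{ for all }n\in\mathbb N\}$. *)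

theory Defs
  imports "HOL-Algebra.Algebra" "HOL-Library.Multiset"
begin

section \<open>Quotient group, seminormalization, complete integral closure\<close>

text \<open>
  A commutative cancellative monoid \<open>H\<close> is given as a submonoid of an abelian group \<open>Q\<close>.
  Its quotient group is then realized inside \<open>Q\<close>, as the set of all fractions of elements
  of \<open>H\<close>. This is the usual identification \<open>q(H) \<subseteq> q(M)\<close> for \<open>H \<subseteq> M\<close>, which is what makes
  it meaningful to compare subsets of \<open>q(H)\<close> with subsets of \<open>M\<close>.
\<close>

definition quotient_grp :: "('a, 'b) monoid_scheme \<Rightarrow> 'a set \<Rightarrow> 'a set"
  where "quotient_grp Q H = {a \<otimes>\<^bsub>Q\<^esub> inv\<^bsub>Q\<^esub> b | a b. a \<in> H \<and> b \<in> H}"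

definition seminormalization :: "('a, 'b) monoid_scheme \<Rightarrow> 'a set \<Rightarrow> 'a set"
  where "seminormalization Q H =
    {x \<in> quotient_grp Q H. \<exists>N::nat. N \<ge> 1 \<and> (\<forall>n::nat. n \<ge> N \<longrightarrow> x [^]\<^bsub>Q\<^esub> n \<in> H)}"

definition seminormal :: "('a, 'b) monoid_scheme \<Rightarrow> 'a set \<Rightarrow> bool"
  where "seminormal Q H \<longleftrightarrow> H = seminormalization Q H"

definition complete_integral_closure :: "('a, 'b) monoid_scheme \<Rightarrow> 'a set \<Rightarrow> 'a set"
  where "complete_integral_closure Q H =
    {x \<in> quotient_grp Q H. \<exists>c\<in>H. \<forall>n::nat. n \<ge> 1 \<longrightarrow> c \<otimes>\<^bsub>Q\<^esub> x [^]\<^bsub>Q\<^esub> n \<in> H}"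

lemma (in comm_group) subgroup_quotient_grp:
  assumes "submonoid H G"
  shows "subgroup (quotient_grp G H) G" "H \<subseteq> quotient_grp G H"
proof -
  interpret H: submonoid H G by fact
  note sub = subsetD[OF H.subset]
  show "H \<subseteq> quotient_grp G H"
  proof
    fix x assume "x \<in> H"
    then have "x = x \<otimes> inv \<one>" by (simp add: sub)
    then show "x \<in> quotient_grp G H"
      unfolding quotient_grp_def using \<open>x \<in> H\<close> H.one_closed by blast
  qed
  show "subgroup (quotient_grp G H) G"
  proof (rule subgroupI)
    show "quotient_grp G H \<subseteq> carrier G" by (auto simp: quotient_grp_def sub)
    show "quotient_grp G H \<noteq> {}"
      using \<open>H \<subseteq> quotient_grp G H\<close> H.one_closed by blast
  next
    fix x assume "x \<in> quotient_grp G H"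
    then obtain a b where ab: "a \<in> H" "b \<in> H" "x = a \<otimes> inv b" by (auto simp: quotient_grp_def)
    then have "inv x = b \<otimes> inv a" by (simp add: sub inv_mult_group)
    then show "inv x \<in> quotient_grp G H" using ab by (auto simp: quotient_grp_def)
  next
    fix x y assume "x \<in> quotient_grp G H" "y \<in> quotient_grp G H"
    then obtain a b c d where ab: "a \<in> H" "b \<in> H" "x = a \<otimes> inv b"
      and cd: "c \<in> H" "d \<in> H" "y = c \<otimes> inv d" by (auto simp: quotient_grp_def)
    then have "x \<otimes> y = (a \<otimes> c) \<otimes> inv (b \<otimes> d)" by (simp add: sub inv_mult m_ac)
    then show "x \<otimes> y \<in> quotient_grp G H"
      unfolding quotient_grp_def using ab cd H.m_closed by blast
  qed
qed


section \<open>Sequences over a finite abelian group\<close>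

text \<open>
  The abelian group \<open>G\<close> is a multiplicatively written \<^locale>\<open>comm_group\<close>: the additive
  \<open>g + h\<close>, \<open>0\<close>, \<open>-g\<close>, \<open>2g\<close> read \<open>g \<otimes> h\<close>, \<open>\<one>\<close>, \<open>inv g\<close>, \<open>g \<otimes> g\<close>.
  The free abelian monoid with basis \<open>carrier G\<close> consists of the finite multisets over
  \<open>carrier G\<close>, with multiset union as its operation. Its quotient group is the library's
  \<^const>\<open>free_Abelian_group\<close>, into which it is embedded by \<open>frag_of_mset\<close>.
\<close>

definition free_abelian_monoid :: "('a, 'b) monoid_scheme \<Rightarrow> 'a multiset set"
  where "free_abelian_monoid G = {S. set_mset S \<subseteq> carrier G}"

definition frag_of_mset :: "'a multiset \<Rightarrow> ('a \<Rightarrow>\<^sub>0 int)"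
  where "frag_of_mset S = (\<Sum>g\<in>#S. frag_of g)"

definition seq_sum :: "('a, 'b) monoid_scheme \<Rightarrow> 'a multiset \<Rightarrow> 'a"
  where "seq_sum G S = (\<Otimes>\<^bsub>G\<^esub>g\<in>set_mset S. g [^]\<^bsub>G\<^esub> count S g)"

text \<open>The endomorphisms \<open>\<gamma> i\<close> are attached to the positions of the sequence, so equal terms
  may be moved by different elements of \<open>\<Gamma>\<close>.\<close>

definition weighted_zero_sum :: "('a, 'b) monoid_scheme \<Rightarrow> ('a \<Rightarrow> 'a) set \<Rightarrow> 'a multiset set"
  where "weighted_zero_sum G \<Gamma> =
    {mset gs | gs. set gs \<subseteq> carrier G \<and>
       (\<exists>\<gamma>::nat \<Rightarrow> 'a \<Rightarrow> 'a. (\<forall>i<length gs. \<gamma> i \<in> \<Gamma>) \<and>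
          (\<Otimes>\<^bsub>G\<^esub>i\<in>{..<length gs}. \<gamma> i (gs ! i)) = \<one>\<^bsub>G\<^esub>)}"

text \<open>Endomorphisms are extensional functions, as in the library's \<^const>\<open>auto\<close>
  (the automorphisms of \<open>G\<close>).\<close>

definition plus_minus_id :: "('a, 'b) monoid_scheme \<Rightarrow> ('a \<Rightarrow> 'a) set"
  where "plus_minus_id G = {\<lambda>x\<in>carrier G. x, \<lambda>x\<in>carrier G. inv\<^bsub>G\<^esub> x}"

abbreviation plus_minus_zero_sum :: "('a, 'b) monoid_scheme \<Rightarrow> 'a multiset set"
  where "plus_minus_zero_sum G \<equiv> weighted_zero_sum G (plus_minus_id G)"

definition seq_seminormal :: "('a, 'b) monoid_scheme \<Rightarrow> 'a multiset set \<Rightarrow> bool"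
  where "seq_seminormal G B \<longleftrightarrow>
    seminormal (free_Abelian_group (carrier G)) (frag_of_mset ` B)"

definition seq_closure :: "('a, 'b) monoid_scheme \<Rightarrow> 'a multiset set \<Rightarrow> ('a \<Rightarrow>\<^sub>0 int) set"
  where "seq_closure G B =
    complete_integral_closure (free_Abelian_group (carrier G)) (frag_of_mset ` B)"

definition group_exp :: "('a, 'b) monoid_scheme \<Rightarrow> nat"
  where "group_exp G = Lcm (group.ord G ` carrier G)"

definition double_set :: "('a, 'b) monoid_scheme \<Rightarrow> 'a set"
  where "double_set G = {g \<otimes>\<^bsub>G\<^esub> g | g. g \<in> carrier G}"

definition cyclic_2_sum :: "nat \<Rightarrow> (nat \<Rightarrow> nat) \<Rightarrow> (nat \<Rightarrow> int) monoid"
  where "cyclic_2_sum r t = sum_group {1..r} (\<lambda>i. integer_mod_group (2 ^ t i))"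

definition num_of_order :: "('a, 'b) monoid_scheme \<Rightarrow> nat \<Rightarrow> 'a multiset \<Rightarrow> nat"
  where "num_of_order G m S = size {#g \<in># S. group.ord G g = m#}"


subsection \<open>Sanity checks for the encoding\<close>

lemma frag_of_mset_union: "frag_of_mset (S + T) = frag_of_mset S + frag_of_mset T"
  by (simp add: frag_of_mset_def)

lemma lookup_frag_of_mset: "Poly_Mapping.lookup (frag_of_mset S) g = int (count S g)"
  by (induction S) (auto simp: frag_of_mset_def lookup_add)

lemma inj_frag_of_mset: "inj frag_of_mset"
  by (rule injI, rule multiset_eqI) (metis lookup_frag_of_mset of_nat_eq_iff)

lemma frag_of_mset_free_abelian_monoid:
  "frag_of_mset ` free_abelian_monoid G \<subseteq> carrier (free_Abelian_group (carrier G))"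
  by (auto simp: free_abelian_monoid_def free_Abelian_group_def in_keys_iff lookup_frag_of_mset)

lemma quotient_grp_free_abelian_monoid:
  "quotient_grp (free_Abelian_group (carrier G)) (frag_of_mset ` free_abelian_monoid G) =
    carrier (free_Abelian_group (carrier G))" (is "?L = ?R")
proof
  interpret Q: comm_group "free_Abelian_group (carrier G)"
    by (rule abelian_free_Abelian_group)
  have sub: "submonoid (frag_of_mset ` free_abelian_monoid G) (free_Abelian_group (carrier G))"
  proof
    show "frag_of_mset ` free_abelian_monoid G \<subseteq> carrier (free_Abelian_group (carrier G))"
      by (rule frag_of_mset_free_abelian_monoid)
  next
    fix x y assume "x \<in> frag_of_mset ` free_abelian_monoid G" "y \<in> frag_of_mset ` free_abelian_monoid G"
    then obtain S T where "x = frag_of_mset S" "y = frag_of_mset T"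
      "S + T \<in> free_abelian_monoid G" by (auto simp: free_abelian_monoid_def)
    then show "x \<otimes>\<^bsub>free_Abelian_group (carrier G)\<^esub> y \<in> frag_of_mset ` free_abelian_monoid G"
      by (auto simp: frag_of_mset_union[symmetric])
  next
    have "frag_of_mset {#} = \<one>\<^bsub>free_Abelian_group (carrier G)\<^esub>" by (simp add: frag_of_mset_def)
    then show "\<one>\<^bsub>free_Abelian_group (carrier G)\<^esub> \<in> frag_of_mset ` free_abelian_monoid G"
      by (metis (no_types, lifting) empty_subsetI free_abelian_monoid_def image_eqI mem_Collect_eq set_mset_empty)
  qed
  note Q = Q.subgroup_quotient_grp[OF sub]
  show "?L \<subseteq> ?R" using subgroup.subset[OF Q(1)] .
  show "?R \<subseteq> ?L"
  proof
    fix c assume "c \<in> ?R"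
    then have "Poly_Mapping.keys c \<subseteq> carrier G" by (simp add: free_Abelian_group_def)
    then show "c \<in> ?L"
    proof (induction c rule: frag_induction)
      case zero
      show ?case using subgroup.one_closed[OF Q(1)] by simp
    next
      case (one x)
      then have "frag_of_mset {#x#} \<in> ?L"
        using Q(2) by (auto simp: free_abelian_monoid_def)
      then show ?case by (simp add: frag_of_mset_def)
    next
      case (diff a b)
      have b: "b \<in> carrier (free_Abelian_group (carrier G))"
        using diff(2) subgroup.subset[OF Q(1)] by blast
      have "inv\<^bsub>free_Abelian_group (carrier G)\<^esub> b = - b"
        using b Q.inv_equality[of "- b" b] by (simp add: free_Abelian_group_def)
      then have "a - b = a \<otimes>\<^bsub>free_Abelian_group (carrier G)\<^esub> inv\<^bsub>free_Abelian_group (carrier G)\<^esub> b"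
        by simp
      then show ?case
        by (simp only: subgroup.m_closed[OF Q(1) diff(1) subgroup.m_inv_closed[OF Q(1) diff(2)]])
    qed
  qed
qed

lemma (in comm_group) seq_sum_add_mset:
  assumes "set_mset S \<subseteq> carrier G" "g \<in> carrier G"
  shows "seq_sum G (add_mset g S) = seq_sum G S \<otimes> g"
proof -
  have c: "(\<lambda>x. x [^] count S x) \<in> A \<rightarrow> carrier G" if "A \<subseteq> set_mset S" for A
    using that assms by auto
  have "seq_sum G (add_mset g S) =
      (\<Otimes>x\<in>insert g (set_mset S - {g}). x [^] count (add_mset g S) x)"
    by (simp add: seq_sum_def)
  also have "\<dots> = g [^] Suc (count S g) \<otimes> (\<Otimes>x\<in>set_mset S - {g}. x [^] count (add_mset g S) x)"
    using assms by (subst finprod_insert) auto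
  also have "(\<Otimes>x\<in>set_mset S - {g}. x [^] count (add_mset g S) x) =
      (\<Otimes>x\<in>set_mset S - {g}. x [^] count S x)"
    using assms by (intro finprod_cong') auto
  finally have 1: "seq_sum G (add_mset g S) =
      g [^] Suc (count S g) \<otimes> (\<Otimes>x\<in>set_mset S - {g}. x [^] count S x)" .
  have 2: "seq_sum G S = g [^] count S g \<otimes> (\<Otimes>x\<in>set_mset S - {g}. x [^] count S x)"
  proof (cases "g \<in># S")
    case True
    then have "seq_sum G S = (\<Otimes>x\<in>insert g (set_mset S - {g}). x [^] count S x)"
      by (simp add: seq_sum_def insert_absorb)
    also have "\<dots> = g [^] count S g \<otimes> (\<Otimes>x\<in>set_mset S - {g}. x [^] count S x)"
      using assms by (subst finprod_insert) auto
    finally show ?thesis .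
  next
    case False
    then have "set_mset S - {g} = set_mset S" "count S g = 0"
      by (auto simp: not_in_iff)
    then show ?thesis using c[of "set_mset S"] by (simp add: seq_sum_def)
  qed
  have d: "(\<Otimes>x\<in>set_mset S - {g}. x [^] count S x) \<in> carrier G"
    using c by (intro finprod_closed) auto
  show ?thesis unfolding 1 2 using assms d by (simp add: m_ac)
qed

lemma (in comm_group) seq_sum_mset:
  assumes "set gs \<subseteq> carrier G"
  shows "seq_sum G (mset gs) = (\<Otimes>i\<in>{..<length gs}. gs ! i)"
  using assms
proof (induction gs rule: rev_induct)
  case Nil
  then show ?case by (simp add: seq_sum_def)
next
  case (snoc g gs)
  then have c: "(!) gs \<in> {..<length gs} \<rightarrow> carrier G" by auto
  have "(\<Otimes>i\<in>{..<length gs}. (gs @ [g]) ! i) = (\<Otimes>i\<in>{..<length gs}. gs ! i)"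
    using c by (intro finprod_cong) (auto simp: simp_implies_def nth_append)
  moreover have "(\<Otimes>i\<in>{..<length (gs @ [g])}. (gs @ [g]) ! i) =
      g \<otimes> (\<Otimes>i\<in>{..<length gs}. (gs @ [g]) ! i)"
    using snoc.prems by (simp add: lessThan_Suc, subst finprod_insert) (auto simp: nth_append)
  moreover have "(\<Otimes>i\<in>{..<length gs}. gs ! i) \<in> carrier G"
    using c by (intro finprod_closed)
  ultimately show ?case
    using snoc by (simp add: seq_sum_add_mset m_comm)
qed

lemma (in comm_group) weighted_zero_sum_add:
  assumes \<Gamma>: "\<Gamma> \<subseteq> hom G G"
    and "S \<in> weighted_zero_sum G \<Gamma>" "T \<in> weighted_zero_sum G \<Gamma>"
  shows "S + T \<in> weighted_zero_sum G \<Gamma>"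
proof -
  obtain gs \<gamma> where g: "S = mset gs" "set gs \<subseteq> carrier G" "\<And>i. i < length gs \<Longrightarrow> \<gamma> i \<in> \<Gamma>"
    "(\<Otimes>i\<in>{..<length gs}. \<gamma> i (gs ! i)) = \<one>"
    using assms(2) by (auto simp: weighted_zero_sum_def)
  obtain hs \<delta> where h: "T = mset hs" "set hs \<subseteq> carrier G" "\<And>i. i < length hs \<Longrightarrow> \<delta> i \<in> \<Gamma>"
    "(\<Otimes>i\<in>{..<length hs}. \<delta> i (hs ! i)) = \<one>"
    using assms(3) by (auto simp: weighted_zero_sum_def)
  define \<epsilon> where "\<epsilon> i = (if i < length gs then \<gamma> i else \<delta> (i - length gs))" for i
  define f where "f i = \<epsilon> i ((gs @ hs) ! i)" for i
  have \<epsilon>: "\<epsilon> i \<in> \<Gamma>" if "i < length (gs @ hs)" for i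
    using that g(3)[of i] h(3)[of "i - length gs"] by (auto simp: \<epsilon>_def)
  have f: "f i \<in> carrier G" if "i < length (gs @ hs)" for i
  proof -
    have "(gs @ hs) ! i \<in> set (gs @ hs)" using that nth_mem by blast
    then have "(gs @ hs) ! i \<in> carrier G" using g(2) h(2) by auto
    then show ?thesis using \<epsilon>[OF that] \<Gamma> by (auto simp: f_def hom_def)
  qed
  have split: "{..<length (gs @ hs)} = {..<length gs} \<union> (\<lambda>i. length gs + i) ` {..<length hs}"
  proof (rule Set.set_eqI)
    fix i
    have "i = length gs + (i - length gs)" if "\<not> i < length gs" using that by simp
    then show "i \<in> {..<length (gs @ hs)} \<longleftrightarrow>
        i \<in> {..<length gs} \<union> (\<lambda>i. length gs + i) ` {..<length hs}"
      by (cases "i < length gs") (auto simp: image_iff intro!: bexI[of _ "i - length gs"])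
  qed
  have "(\<Otimes>i\<in>{..<length (gs @ hs)}. f i) =
      (\<Otimes>i\<in>{..<length gs}. f i) \<otimes> (\<Otimes>i\<in>(\<lambda>i. length gs + i) ` {..<length hs}. f i)"
    unfolding split using f by (intro finprod_Un_disjoint) auto
  also have "(\<Otimes>i\<in>(\<lambda>i. length gs + i) ` {..<length hs}. f i) =
      (\<Otimes>i\<in>{..<length hs}. f (length gs + i))"
    using f by (intro finprod_reindex) auto
  also have "\<dots> = (\<Otimes>i\<in>{..<length hs}. \<delta> i (hs ! i))"
    by (rule arg_cong2[where f="\<lambda>u v. finprod G u v"] finprod_cong')+
      (use f[of "length gs + _"] in \<open>force simp: f_def \<epsilon>_def\<close>)+
  also have "(\<Otimes>i\<in>{..<length gs}. f i) = (\<Otimes>i\<in>{..<length gs}. \<gamma> i (gs ! i))"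
  proof (rule finprod_cong')
    have eq: "f i = \<gamma> i (gs ! i)" if "i < length gs" for i
      using that by (simp add: f_def \<epsilon>_def nth_append)
    then show "(\<lambda>i. \<gamma> i (gs ! i)) \<in> {..<length gs} \<rightarrow> carrier G"
      using f by (metis (no_types, lifting) Pi_I length_append lessThan_iff trans_less_add1)
    show "f i = \<gamma> i (gs ! i)" if "i \<in> {..<length gs}" for i using that eq by simp
  qed simp
  finally have "(\<Otimes>i\<in>{..<length (gs @ hs)}. \<epsilon> i ((gs @ hs) ! i)) = \<one>"
    using g(4) h(4) by (simp add: f_def)
  moreover have "S + T = mset (gs @ hs)" "set (gs @ hs) \<subseteq> carrier G" using g h by auto
  ultimately show ?thesis unfolding weighted_zero_sum_def using \<epsilon> by blast
qed

lemma (in group) plus_minus_id_auto: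
  assumes "comm_group G"
  shows "plus_minus_id G \<subseteq> auto G"
proof -
  interpret comm_group G by fact
  have "(\<lambda>x\<in>carrier G. inv x) \<in> hom G G" by (auto simp: hom_def inv_mult)
  moreover have "bij_betw (\<lambda>x\<in>carrier G. inv x) (carrier G) (carrier G)"
    by (rule bij_betwI[where g="\<lambda>x\<in>carrier G. inv x"]) auto
  ultimately show ?thesis
    using id_in_auto by (simp add: plus_minus_id_def auto_def Bij_def)
qed

end

theory Submission
  imports Defs
begin

text \<open>
  In the comments \<open>G\<close> is written additively and the monoid of sequences multiplicatively. Write \<open>B\<close> for the monoid of weighted zero-sum sequences. Since \<open>id\<close> and \<open>-id\<close> are
  weights, \<open>g g \<in> B\<close> for every \<open>g\<close>, so the even powers of every sequence lie in \<open>B\<close>.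
  Two consequences govern the whole proof. The monoid \<open>B\<close> is seminormal if and only if a sequence
  with an odd power in \<open>B\<close> lies itself in \<open>B\<close> (\<open>seminormal_iff\<close>), and the complete integral
  closure of \<open>B\<close> consists of all sequences in the quotient group of \<open>B\<close> (\<open>closure_eq\<close>).

  Seminormality fails in three ways, each with a small witness. If \<open>g\<close> has odd order \<open>m > 1\<close>, then
  \<open>g ^ m \<in> B\<close>, but \<open>g\<close> is not in \<open>B\<close>; hence all orders are powers of 2, since an element of any other
  order has a multiple of odd order greater than 1. For the weights \<open>\<plusminus>id\<close> the
  cube of \<open>g (3 g)\<close> lies in \<open>B\<close> because \<open>g + g + g + 3 g - 3 g - 3 g = 0\<close>, while \<open>g (3 g) \<in> B\<close> forces
  \<open>4 g = 0\<close>. For all automorphisms, \<open>\<alpha> g + \<beta> g + \<gamma> g = 0\<close> means that \<open>g ^ 3 \<in> B\<close>,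
  and again \<open>g \<in> B\<close> only for \<open>g = 0\<close>.

  Seminormality holds as soon as each sum \<open>\<alpha> g + \<beta> g + \<gamma> g\<close> of weighted copies of \<open>g\<close> is again
  of the form \<open>\<delta> g\<close> for a weight \<open>\<delta>\<close>: then an odd number of copies of \<open>g\<close> contributes what a single
  copy can contribute (\<open>seminormalI\<close>). For \<open>\<plusminus>id\<close> this is clear when \<open>4 g = 0\<close>. For
  \<open>Aut(G)\<close> with \<open>G\<close> a sum of cyclic 2-groups of pairwise distinct orders, a sum of three automorphisms
  is an automorphism (\<open>sum_of_three_autos\<close>): filter the elements of order at most 2 by their membership
  in \<open>2 ^ k G\<close>. Each factor of this filtration has at most two elements, so all automorphisms act on it
  as the identity, and a sum of three of them acts as multiplication by 3, which is again the identity.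
  A sum with a kernel would kill an element of order 2.

  Conversely, let \<open>G\<close> be a finite abelian 2-group in which \<open>\<alpha> g + \<beta> g + \<gamma> g = 0\<close> only for \<open>g = 0\<close>. An
  element \<open>e\<close> of maximal order spans a direct summand (\<open>cyclic_complement_exists\<close>), and automorphisms
  act transitively on the elements of maximal order (\<open>auto_transitive_max_order\<close>). A complement of \<open>e\<close>
  cannot contain an element \<open>f\<close> of the order of \<open>e\<close>, for \<open>e\<close>, \<open>f\<close> and \<open>-(e + f)\<close> would lie in one orbit
  and add up to \<open>0\<close>. The complement inherits the property, so induction on the size of \<open>G\<close> yields cyclic
  summands of strictly increasing orders (\<open>three_free_imp_cyclic_2_sum\<close>).

  The two closures are computed from invariants of the quotient group. For \<open>\<plusminus>id\<close> changing a sign changes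
  the sum by an element of \<open>2G\<close>. For \<open>Aut(G)\<close> the elements of maximal order are those whose last
  coordinate is odd, so the parity of their number is the parity of the last coordinate of any attainable
  sum; transitivity on these elements shows that there is no further obstruction.
\<close>

section \<open>Sums attainable with weights\<close>

text \<open>The sums \<open>\<gamma>\<^sub>1 g\<^sub>1 + \<dots> + \<gamma>\<^sub>l g\<^sub>l\<close> attainable from a sequence, built up term by term. This
order-free description replaces positions in a list by multiset operations.\<close>

inductive weighted_sum :: "('a, 'b) monoid_scheme \<Rightarrow> ('a \<Rightarrow> 'a) set \<Rightarrow> 'a multiset \<Rightarrow> 'a \<Rightarrow> bool"
  for G (structure) and \<Gamma> where
  empty: "weighted_sum G \<Gamma> {#} \<one>"
| add: "weighted_sum G \<Gamma> S x \<Longrightarrow> \<gamma> \<in> \<Gamma> \<Longrightarrow> g \<in> carrier G \<Longrightarrow>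
    weighted_sum G \<Gamma> (add_mset g S) (\<gamma> g \<otimes> x)"

locale signed_weights = comm_group G for G (structure) +
  fixes \<Gamma>
  assumes weights_auto: "\<Gamma> \<subseteq> auto G" and plus_minus_weights: "plus_minus_id G \<subseteq> \<Gamma>"
begin

lemma weight_closed: "\<gamma> \<in> \<Gamma> \<Longrightarrow> g \<in> carrier G \<Longrightarrow> \<gamma> g \<in> carrier G"
  using weights_auto by (auto simp: auto_def hom_def)

lemma weight_eq_one_iff: "\<gamma> \<in> \<Gamma> \<Longrightarrow> g \<in> carrier G \<Longrightarrow> \<gamma> g = \<one> \<longleftrightarrow> g = \<one>"
proof -
  assume "\<gamma> \<in> \<Gamma>" "g \<in> carrier G"
  then have "\<gamma> \<in> hom G G" "inj_on \<gamma> (carrier G)"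
    using weights_auto by (auto simp: auto_def Bij_def bij_betw_def)
  then show ?thesis using \<open>g \<in> carrier G\<close> hom_one[of \<gamma> G G] inj_onD[of \<gamma> "carrier G" g \<one>]
    by auto
qed

lemma weighted_sum_closed:
  "weighted_sum G \<Gamma> S x \<Longrightarrow> S \<in> free_abelian_monoid G \<and> x \<in> carrier G"
proof (induction rule: weighted_sum.induct)
  case (add S x \<gamma> g)
  then show ?case using weight_closed[of \<gamma> g] by (simp add: free_abelian_monoid_def)
qed (simp add: free_abelian_monoid_def)

text \<open>Attainable sums do not depend on the order in which the terms are added: any term may be
taken to be the last one. This gives the recursion \<open>weighted_sum_add_mset\<close>.\<close>

lemma weighted_sum_remove:
  assumes "weighted_sum G \<Gamma> S x" "g \<in># S"
  shows "\<exists>\<gamma>\<in>\<Gamma>. \<exists>y. weighted_sum G \<Gamma> (S - {#g#}) y \<and> x = \<gamma> g \<otimes> y"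
  using assms
proof (induction rule: weighted_sum.induct)
  case (add S x \<delta> h)
  show ?case
  proof (cases "g = h")
    case False
    then have "g \<in># S" using add.prems by simp
    then obtain \<gamma> y where y: "\<gamma> \<in> \<Gamma>" "weighted_sum G \<Gamma> (S - {#g#}) y" "x = \<gamma> g \<otimes> y"
      using add.IH by blast
    then have "weighted_sum G \<Gamma> (add_mset h (S - {#g#})) (\<delta> h \<otimes> y)"
      using add.hyps by (intro weighted_sum.add)
    moreover have "add_mset h (S - {#g#}) = add_mset h S - {#g#}" using False by simp
    moreover have "g \<in> carrier G"
      using \<open>g \<in># S\<close> weighted_sum_closed[OF add.hyps(1)] by (auto simp: free_abelian_monoid_def)
    ultimately have "weighted_sum G \<Gamma> (add_mset h S - {#g#}) (\<delta> h \<otimes> y)" "g \<in> carrier G" by simp_all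
    moreover have "\<delta> h \<otimes> x = \<gamma> g \<otimes> (\<delta> h \<otimes> y)"
      unfolding y(3) using y(1) add.hyps weight_closed[of \<gamma> g] weight_closed[of \<delta> h]
        weighted_sum_closed[OF y(2)] calculation by (simp add: m_lcomm)
    ultimately show ?thesis using y(1) by blast
  next
    case True
    have "add_mset h S - {#g#} = S" using True by simp
    then show ?thesis using True add.hyps by metis
  qed
qed simp

lemma weighted_sum_add_mset:
  "weighted_sum G \<Gamma> (add_mset g S) x \<longleftrightarrow>
    g \<in> carrier G \<and> (\<exists>\<gamma>\<in>\<Gamma>. \<exists>y. weighted_sum G \<Gamma> S y \<and> x = \<gamma> g \<otimes> y)"
proof
  assume *: "weighted_sum G \<Gamma> (add_mset g S) x"
  then have "g \<in> carrier G" using weighted_sum_closed by (fastforce simp: free_abelian_monoid_def)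
  with weighted_sum_remove[OF *, of g] show "g \<in> carrier G \<and> (\<exists>\<gamma>\<in>\<Gamma>. \<exists>y. weighted_sum G \<Gamma> S y \<and> x = \<gamma> g \<otimes> y)"
    by simp
qed (blast intro: weighted_sum.add)

lemma weighted_sum_empty [simp]: "weighted_sum G \<Gamma> {#} x \<longleftrightarrow> x = \<one>"
  by (auto intro: weighted_sum.empty elim: weighted_sum.cases)

lemma weighted_sum_union:
  "weighted_sum G \<Gamma> (S + T) x \<longleftrightarrow>
    (\<exists>y z. weighted_sum G \<Gamma> S y \<and> weighted_sum G \<Gamma> T z \<and> x = y \<otimes> z)"
proof (induction S arbitrary: x)
  case empty
  then show ?case using weighted_sum_closed by auto
next
  case (add g S)
  have assoc: "\<gamma> g \<otimes> (u \<otimes> z) = \<gamma> g \<otimes> u \<otimes> z"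
    if "g \<in> carrier G" "\<gamma> \<in> \<Gamma>" "weighted_sum G \<Gamma> S u" "weighted_sum G \<Gamma> T z" for \<gamma> u z
    using that weight_closed[of \<gamma> g] weighted_sum_closed[of S u] weighted_sum_closed[of T z] by (simp add: m_assoc)
  show ?case
  proof
    assume "weighted_sum G \<Gamma> (add_mset g S + T) x"
    then obtain \<gamma> u z where *: "g \<in> carrier G" "\<gamma> \<in> \<Gamma>" "weighted_sum G \<Gamma> S u"
      "weighted_sum G \<Gamma> T z" "x = \<gamma> g \<otimes> (u \<otimes> z)"
      unfolding union_mset_add_mset_left weighted_sum_add_mset[of g "S + T"] add.IH by blast
    then have "weighted_sum G \<Gamma> (add_mset g S) (\<gamma> g \<otimes> u)" "x = \<gamma> g \<otimes> u \<otimes> z"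
      using assoc by (blast intro: weighted_sum.add)+
    with *(4) show "\<exists>y z. weighted_sum G \<Gamma> (add_mset g S) y \<and> weighted_sum G \<Gamma> T z \<and> x = y \<otimes> z"
      by blast
  next
    assume "\<exists>y z. weighted_sum G \<Gamma> (add_mset g S) y \<and> weighted_sum G \<Gamma> T z \<and> x = y \<otimes> z"
    then obtain \<gamma> u z where *: "g \<in> carrier G" "\<gamma> \<in> \<Gamma>" "weighted_sum G \<Gamma> S u"
      "weighted_sum G \<Gamma> T z" "x = \<gamma> g \<otimes> u \<otimes> z"
      unfolding weighted_sum_add_mset by blast
    then have "weighted_sum G \<Gamma> (S + T) (u \<otimes> z)" using add.IH by blast
    then have "weighted_sum G \<Gamma> (add_mset g (S + T)) (\<gamma> g \<otimes> (u \<otimes> z))"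
      using * by (intro weighted_sum.add)
    with * assoc show "weighted_sum G \<Gamma> (add_mset g S + T) x" by simp
  qed
qed

lemma weighted_sum_single:
  "weighted_sum G \<Gamma> {#g#} x \<longleftrightarrow> g \<in> carrier G \<and> (\<exists>\<gamma>\<in>\<Gamma>. x = \<gamma> g)"
  using weight_closed[of _ g] by (force simp: weighted_sum_add_mset)

lemma ident_weight: "(\<lambda>x\<in>carrier G. x) \<in> \<Gamma>"
  and inv_weight: "(\<lambda>x\<in>carrier G. inv x) \<in> \<Gamma>"
  using plus_minus_weights by (auto simp: plus_minus_id_def)

lemma weighted_sum_pm:
  assumes "g \<in> carrier G" shows "weighted_sum G \<Gamma> {#g#} g" "weighted_sum G \<Gamma> {#g#} (inv g)"
  using assms ident_weight inv_weight
  by (auto simp: weighted_sum_single intro: bexI[of _ "\<lambda>x\<in>carrier G. x"] bexI[of _ "\<lambda>x\<in>carrier G. inv x"])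

lemma weighted_sum_mset:
  "weighted_sum G \<Gamma> S x \<longleftrightarrow> (\<exists>gs. S = mset gs \<and> set gs \<subseteq> carrier G \<and>
     (\<exists>\<gamma>. (\<forall>i<length gs. \<gamma> i \<in> \<Gamma>) \<and> (\<Otimes>i\<in>{..<length gs}. \<gamma> i (gs ! i)) = x))"
proof -
  have append: "(\<Otimes>i\<in>{..<length (gs @ [g])}. \<gamma> i ((gs @ [g]) ! i)) =
      \<gamma> (length gs) g \<otimes> (\<Otimes>i\<in>{..<length gs}. \<gamma> i (gs ! i))"
    if "set (gs @ [g]) \<subseteq> carrier G" "\<forall>i<length (gs @ [g]). \<gamma> i \<in> \<Gamma>" for gs g \<gamma>
  proof -
    have c: "\<gamma> i (gs ! i) \<in> carrier G" if "i < length gs" for i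
      using that \<open>set (gs @ [g]) \<subseteq> carrier G\<close> \<open>\<forall>i<length (gs @ [g]). \<gamma> i \<in> \<Gamma>\<close> nth_mem[OF that]
      by (intro weight_closed[of "\<gamma> i" "gs ! i"]) auto
    have "(\<Otimes>i\<in>{..<length (gs @ [g])}. \<gamma> i ((gs @ [g]) ! i)) =
        (\<Otimes>i\<in>insert (length gs) {..<length gs}. \<gamma> i ((gs @ [g]) ! i))"
      by (simp add: lessThan_Suc)
    also have "\<dots> = \<gamma> (length gs) g \<otimes> (\<Otimes>i\<in>{..<length gs}. \<gamma> i ((gs @ [g]) ! i))"
      using that c weight_closed[of "\<gamma> (length gs)" g] by (subst finprod_insert) (auto simp: nth_append)
    also have "(\<Otimes>i\<in>{..<length gs}. \<gamma> i ((gs @ [g]) ! i)) = (\<Otimes>i\<in>{..<length gs}. \<gamma> i (gs ! i))"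
      using c by (intro finprod_cong') (auto simp: nth_append)
    finally show ?thesis .
  qed
  have "\<exists>gs. S = mset gs \<and> set gs \<subseteq> carrier G \<and>
     (\<exists>\<gamma>. (\<forall>i<length gs. \<gamma> i \<in> \<Gamma>) \<and> (\<Otimes>i\<in>{..<length gs}. \<gamma> i (gs ! i)) = x)"
    if "weighted_sum G \<Gamma> S x" using that
  proof (induction rule: weighted_sum.induct)
    case (add S x \<delta> g)
    then obtain gs \<gamma> where gs: "S = mset gs" "set gs \<subseteq> carrier G" "\<forall>i<length gs. \<gamma> i \<in> \<Gamma>"
      "(\<Otimes>i\<in>{..<length gs}. \<gamma> i (gs ! i)) = x" by blast
    define \<gamma>' where "\<gamma>' = \<gamma>(length gs := \<delta>)"
    have \<gamma>': "\<forall>i<length (gs @ [g]). \<gamma>' i \<in> \<Gamma>" using gs add.hyps by (auto simp: \<gamma>'_def less_Suc_eq)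
    have c: "\<gamma> i (gs ! i) \<in> carrier G" if "i < length gs" for i
      using that gs nth_mem[OF that] by (intro weight_closed[of "\<gamma> i" "gs ! i"]) auto
    have "(\<Otimes>i\<in>{..<length gs}. \<gamma>' i (gs ! i)) = (\<Otimes>i\<in>{..<length gs}. \<gamma> i (gs ! i))"
      using c by (intro finprod_cong') (auto simp: \<gamma>'_def)
    then have "(\<Otimes>i\<in>{..<length (gs @ [g])}. \<gamma>' i ((gs @ [g]) ! i)) = \<delta> g \<otimes> x"
      using append[OF _ \<gamma>'] gs add.hyps by (simp add: \<gamma>'_def del: length_append)
    then show ?case using gs \<gamma>' add.hyps by (intro exI[of _ "gs @ [g]"]) auto
  qed auto
  moreover have "weighted_sum G \<Gamma> (mset gs) (\<Otimes>i\<in>{..<length gs}. \<gamma> i (gs ! i))"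
    if "set gs \<subseteq> carrier G" "\<forall>i<length gs. \<gamma> i \<in> \<Gamma>" for gs \<gamma>
    using that
  proof (induction gs rule: rev_induct)
    case (snoc g gs)
    then have "weighted_sum G \<Gamma> (mset gs) (\<Otimes>i\<in>{..<length gs}. \<gamma> i (gs ! i))"
      by simp
    then have "weighted_sum G \<Gamma> (add_mset g (mset gs))
        (\<gamma> (length gs) g \<otimes> (\<Otimes>i\<in>{..<length gs}. \<gamma> i (gs ! i)))"
      using snoc.prems by (intro weighted_sum.add) auto
    then show ?case unfolding append[OF snoc.prems] by simp
  qed simp
  ultimately show ?thesis by metis
qed

lemma weighted_zero_sum_iff: "S \<in> weighted_zero_sum G \<Gamma> \<longleftrightarrow> weighted_sum G \<Gamma> S \<one>"
  by (auto simp: weighted_zero_sum_def weighted_sum_mset)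

abbreviation B where "B \<equiv> weighted_zero_sum G \<Gamma>"

lemma zero_sum_in_free_monoid: "S \<in> B \<Longrightarrow> S \<in> free_abelian_monoid G"
  using weighted_sum_closed by (auto simp: weighted_zero_sum_iff)

lemma zero_sum_empty: "{#} \<in> B" by (simp add: weighted_zero_sum_iff)

lemma zero_sum_union: "S \<in> B \<Longrightarrow> T \<in> B \<Longrightarrow> S + T \<in> B"
  unfolding weighted_zero_sum_iff weighted_sum_union by (metis l_one one_closed)

text \<open>Each term \<open>g\<close> occurs twice and the two copies cancel as \<open>g - g\<close>.\<close>

lemma zero_sum_double: "S \<in> free_abelian_monoid G \<Longrightarrow> S + S \<in> B"
proof (induction S)
  case (add g S)
  then have g: "g \<in> carrier G" and S: "S + S \<in> B" by (auto simp: free_abelian_monoid_def weight_closed)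
  have "weighted_sum G \<Gamma> ({#g#} + {#g#}) \<one>"
    unfolding weighted_sum_union using weighted_sum_pm[OF g] r_inv[OF g] by metis
  then have "{#g#} + {#g#} \<in> B" by (simp add: weighted_zero_sum_iff)
  from zero_sum_union[OF this S] show ?case by (simp add: add.commute)
qed (simp add: zero_sum_empty)

lemma free_monoid_repeat: "S \<in> free_abelian_monoid G \<Longrightarrow> repeat_mset k S \<in> free_abelian_monoid G"
  by (induction k) (auto simp: free_abelian_monoid_def)

lemma zero_sum_even:
  assumes "S \<in> free_abelian_monoid G" "even k" shows "repeat_mset k S \<in> B"
proof -
  obtain b where "k = 2 * b" using assms(2) by (elim evenE)
  then have "repeat_mset k S = repeat_mset b S + repeat_mset b S" by (intro multiset_eqI) simp
  then show ?thesis using zero_sum_double[OF free_monoid_repeat[OF assms(1)]] by simp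
qed

end

section \<open>Odd powers decide seminormality\<close>

lemma frag_of_mset_repeat: "frag_of_mset (repeat_mset n S) = frag_cmul (int n) (frag_of_mset S)"
  by (rule poly_mapping_eqI) (simp add: lookup_frag_of_mset)

text \<open>The elements of the free abelian group without negative coefficients are the sequences. Both
closure conditions bound the coefficients of multiples of an element from below, and so
confine the closures to sequences.\<close>

lemma nonneg_imp_frag_of_mset:
  assumes "\<And>g. Poly_Mapping.lookup x g \<ge> 0" shows "\<exists>S. x = frag_of_mset S"
proof -
  define S where "S = (\<Sum>g\<in>Poly_Mapping.keys x. replicate_mset (nat (Poly_Mapping.lookup x g)) g)"
  have "count S h = nat (Poly_Mapping.lookup x h)" for h
  proof -
    have "count S h = (\<Sum>g\<in>Poly_Mapping.keys x. if g = h then nat (Poly_Mapping.lookup x h) else 0)"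
      unfolding S_def count_sum by (intro sum.cong) auto
    also have "\<dots> = nat (Poly_Mapping.lookup x h)" by (simp add: in_keys_iff)
    finally show ?thesis .
  qed
  then have "x = frag_of_mset S" using assms by (intro poly_mapping_eqI) (simp add: lookup_frag_of_mset)
  then show ?thesis by blast
qed

context signed_weights
begin

abbreviation Q where "Q \<equiv> free_Abelian_group (carrier G)"

lemma keys_frag_of_mset: "Poly_Mapping.keys (frag_of_mset S) = set_mset S"
  by (auto simp: in_keys_iff lookup_frag_of_mset)

lemma quotient_grp_keys:
  assumes "x \<in> quotient_grp Q (frag_of_mset ` B)" shows "Poly_Mapping.keys x \<subseteq> carrier G"
proof -
  obtain S T where ST: "S \<in> B" "T \<in> B" and x: "x = frag_of_mset S \<otimes>\<^bsub>Q\<^esub> inv\<^bsub>Q\<^esub> frag_of_mset T"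
    using assms by (auto simp: quotient_grp_def)
  have c: "frag_of_mset S \<in> carrier Q" "frag_of_mset T \<in> carrier Q"
    using ST zero_sum_in_free_monoid by (auto simp: keys_frag_of_mset free_abelian_monoid_def)
  have "x \<in> carrier Q" unfolding x
    using c by (intro monoid.m_closed group.is_monoid group.inv_closed group_free_Abelian_group)
  then show ?thesis by simp
qed

lemma frag_of_mset_in_quotient_grp:
  "frag_of_mset S \<in> quotient_grp Q (frag_of_mset ` B) \<longleftrightarrow> (\<exists>T\<in>B. S + T \<in> B)"
proof
  assume "frag_of_mset S \<in> quotient_grp Q (frag_of_mset ` B)"
  then obtain A T where AT: "A \<in> B" "T \<in> B" "frag_of_mset S = frag_of_mset A \<otimes>\<^bsub>Q\<^esub> inv\<^bsub>Q\<^esub> frag_of_mset T"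
    by (auto simp: quotient_grp_def)
  moreover have "Poly_Mapping.keys (frag_of_mset T) \<subseteq> carrier G"
    using AT zero_sum_in_free_monoid by (auto simp: keys_frag_of_mset free_abelian_monoid_def)
  ultimately have "frag_of_mset (S + T) = frag_of_mset A" by (simp add: frag_of_mset_union)
  then have "S + T = A" by (rule injD[OF inj_frag_of_mset])
  with AT show "\<exists>T\<in>B. S + T \<in> B" by blast
next
  assume "\<exists>T\<in>B. S + T \<in> B"
  then obtain T where T: "T \<in> B" "S + T \<in> B" by blast
  have "Poly_Mapping.keys (frag_of_mset T) \<subseteq> carrier G"
    using T zero_sum_in_free_monoid by (auto simp: keys_frag_of_mset free_abelian_monoid_def)
  then have "frag_of_mset S = frag_of_mset (S + T) \<otimes>\<^bsub>Q\<^esub> inv\<^bsub>Q\<^esub> frag_of_mset T"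
    by (simp add: frag_of_mset_union)
  with T show "frag_of_mset S \<in> quotient_grp Q (frag_of_mset ` B)"
    unfolding quotient_grp_def by blast
qed

lemma quotient_grp_nonneg:
  assumes "x \<in> quotient_grp Q (frag_of_mset ` B)" "\<And>g. Poly_Mapping.lookup x g \<ge> 0"
  obtains S where "S \<in> free_abelian_monoid G" "x = frag_of_mset S"
  using nonneg_imp_frag_of_mset[OF assms(2)] quotient_grp_keys[OF assms(1)]
  by (auto simp: keys_frag_of_mset free_abelian_monoid_def)

text \<open>If all large powers of \<open>S\<close> are in \<open>B\<close>, then so is some odd one. Conversely, if \<open>S ^ k\<close> with \<open>k\<close> odd
is in \<open>B\<close>, then multiplying by even powers of \<open>S\<close> gives all larger odd powers, and
\<open>S = S ^ k / S ^ (k - 1)\<close> is in the quotient group.\<close>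

lemma seminormalization_zero_sum:
  "seminormalization Q (frag_of_mset ` B) =
    frag_of_mset ` {S \<in> free_abelian_monoid G. \<exists>k. odd k \<and> repeat_mset k S \<in> B}"
proof (intro equalityI subsetI)
  fix x assume "x \<in> seminormalization Q (frag_of_mset ` B)"
  then obtain N :: nat where x: "x \<in> quotient_grp Q (frag_of_mset ` B)"
    and N: "N \<ge> 1" "\<And>n. n \<ge> N \<Longrightarrow> frag_cmul (int n) x \<in> frag_of_mset ` B"
    by (auto simp: seminormalization_def)
  have "Poly_Mapping.lookup x g \<ge> 0" for g
  proof -
    obtain A where "frag_cmul (int N) x = frag_of_mset A" using N(2) by blast
    then have "int N * Poly_Mapping.lookup x g = int (count A g)"
      by (metis lookup_frag_cmul lookup_frag_of_mset)
    then show ?thesis using N(1) by (metis of_nat_0_le_iff of_nat_0_less_iff zero_le_mult_iff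
          less_le_trans zero_less_one not_less)
  qed
  then obtain S where S: "S \<in> free_abelian_monoid G" "x = frag_of_mset S"
    using quotient_grp_nonneg[OF x] by blast
  have "repeat_mset (2 * N + 1) S \<in> B"
    using N(2)[of "2 * N + 1"] unfolding S(2) frag_of_mset_repeat[symmetric]
    by (simp add: inj_image_mem_iff[OF inj_frag_of_mset])
  with S show "x \<in> frag_of_mset ` {S \<in> free_abelian_monoid G. \<exists>k. odd k \<and> repeat_mset k S \<in> B}"
    by (auto intro!: exI[of _ "2 * N + 1"])
next
  fix x assume "x \<in> frag_of_mset ` {S \<in> free_abelian_monoid G. \<exists>k. odd k \<and> repeat_mset k S \<in> B}"
  then obtain S k where S: "x = frag_of_mset S" "S \<in> free_abelian_monoid G" and k: "odd k" "repeat_mset k S \<in> B"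
    by blast
  have split: "repeat_mset n S = repeat_mset m S + repeat_mset (n - m) S" if "m \<le> n" for m n
    using that by (intro multiset_eqI) (simp flip: distrib_right)
  have "k \<ge> 1" using k(1) by (cases k) auto
  have "repeat_mset n S \<in> B" if "n \<ge> k" for n
  proof (cases "even n")
    case False
    then have "even (n - k)" using k(1) by simp
    then show ?thesis
      using split[OF that] zero_sum_union[OF k(2) zero_sum_even[OF S(2)]] by simp
  qed (rule zero_sum_even[OF S(2)])
  moreover have "x \<in> quotient_grp Q (frag_of_mset ` B)"
    unfolding S(1) frag_of_mset_in_quotient_grp
    using split[OF \<open>k \<ge> 1\<close>] k zero_sum_even[OF S(2), of "k - 1"] by (intro bexI[of _ "repeat_mset (k - 1) S"]) auto
  ultimately show "x \<in> seminormalization Q (frag_of_mset ` B)"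
    using \<open>k \<ge> 1\<close> unfolding seminormalization_def S(1)
    by (auto intro!: exI[of _ k] simp flip: frag_of_mset_repeat)
qed

lemma seminormal_iff:
  "seq_seminormal G B \<longleftrightarrow>
    (\<forall>S k. S \<in> free_abelian_monoid G \<longrightarrow> odd k \<longrightarrow> repeat_mset k S \<in> B \<longrightarrow> S \<in> B)"
proof -
  have 1: "S \<in> free_abelian_monoid G \<and> (\<exists>k. odd k \<and> repeat_mset k S \<in> B)" if "S \<in> B" for S
    using that zero_sum_in_free_monoid by (auto intro!: exI[of _ 1])
  have "seq_seminormal G B \<longleftrightarrow> B = {S \<in> free_abelian_monoid G. \<exists>k. odd k \<and> repeat_mset k S \<in> B}"
    unfolding seq_seminormal_def seminormal_def seminormalization_zero_sum
    by (rule inj_image_eq_iff[OF inj_frag_of_mset])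
  with 1 show ?thesis by blast
qed

text \<open>Let \<open>T\<close> and \<open>S T\<close> be in \<open>B\<close>. Then \<open>T\<close> serves as the common multiplier of all powers of \<open>S\<close>: an odd
power of \<open>S\<close> times \<open>T\<close> is \<open>S T\<close> times an even power of \<open>S\<close>.\<close>

lemma closure_eq:
  "seq_closure G B = frag_of_mset ` {S \<in> free_abelian_monoid G. \<exists>T\<in>B. S + T \<in> B}"
proof (intro equalityI subsetI)
  fix x assume "x \<in> seq_closure G B"
  then obtain c where x: "x \<in> quotient_grp Q (frag_of_mset ` B)" and c: "c \<in> B"
    "\<And>n::nat. n \<ge> 1 \<Longrightarrow> frag_of_mset c + frag_cmul (int n) x \<in> frag_of_mset ` B"
    by (auto simp: seq_closure_def complete_integral_closure_def)
  have "Poly_Mapping.lookup x g \<ge> 0" for g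
  proof (rule ccontr)
    assume neg: "\<not> Poly_Mapping.lookup x g \<ge> 0"
    define n where "n = Suc (count c g)"
    obtain A where "frag_of_mset c + frag_cmul (int n) x = frag_of_mset A"
      using c(2)[of n] by (auto simp: n_def)
    then have "int (count c g) + int n * Poly_Mapping.lookup x g = int (count A g)"
      by (metis lookup_frag_cmul lookup_frag_of_mset lookup_add)
    moreover have "int n * Poly_Mapping.lookup x g \<le> int n * (-1)"
      using neg by (intro mult_left_mono) auto
    ultimately show False by (simp add: n_def)
  qed
  then obtain S where "S \<in> free_abelian_monoid G" "x = frag_of_mset S"
    using quotient_grp_nonneg[OF x] by blast
  with x show "x \<in> frag_of_mset ` {S \<in> free_abelian_monoid G. \<exists>T\<in>B. S + T \<in> B}"
    using frag_of_mset_in_quotient_grp by blast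
next
  fix x assume "x \<in> frag_of_mset ` {S \<in> free_abelian_monoid G. \<exists>T\<in>B. S + T \<in> B}"
  then obtain S T where S: "x = frag_of_mset S" "S \<in> free_abelian_monoid G" and T: "T \<in> B" "S + T \<in> B"
    by blast
  have "T + repeat_mset n S \<in> B" for n
  proof (cases "even n")
    case False
    then have "T + repeat_mset n S = (S + T) + repeat_mset (n - 1) S"
      using False by (cases n) (auto simp: ac_simps)
    moreover have "even (n - 1)" using False by simp
    ultimately show ?thesis using zero_sum_union[OF T(2) zero_sum_even[OF S(2)]] by metis
  qed (use zero_sum_union[OF T(1) zero_sum_even[OF S(2)]] in simp)
  then have "frag_of_mset T + frag_cmul (int n) x \<in> frag_of_mset ` B" for n
    unfolding S(1) frag_of_mset_repeat[symmetric] frag_of_mset_union[symmetric] by blast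
  moreover have "x \<in> quotient_grp Q (frag_of_mset ` B)"
    using S(1) T frag_of_mset_in_quotient_grp by blast
  ultimately show "x \<in> seq_closure G B"
    using T(1) by (auto simp: seq_closure_def complete_integral_closure_def)
qed

text \<open>If three weighted copies of \<open>g\<close> can be replaced by one, then so can any odd number of copies. Doing
this for every term turns an attainable sum of an odd power of \<open>S\<close> into one of \<open>S\<close>.\<close>

lemma seminormalI:
  assumes three: "\<And>g \<alpha> \<beta> \<gamma>. g \<in> carrier G \<Longrightarrow> \<alpha> \<in> \<Gamma> \<Longrightarrow> \<beta> \<in> \<Gamma> \<Longrightarrow> \<gamma> \<in> \<Gamma> \<Longrightarrow>
    \<exists>\<delta>\<in>\<Gamma>. \<alpha> g \<otimes> (\<beta> g \<otimes> \<gamma> g) = \<delta> g"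
  shows "seq_seminormal G B"
proof -
  have single: "\<exists>\<delta>\<in>\<Gamma>. z = \<delta> g"
    if "g \<in> carrier G" "weighted_sum G \<Gamma> (replicate_mset (2 * j + 1) g) z" for g j z
    using that(2)
  proof (induction j arbitrary: z)
    case 0
    then show ?case by (simp add: weighted_sum_single)
  next
    case (Suc j)
    have "replicate_mset (2 * Suc j + 1) g = add_mset g (add_mset g (replicate_mset (2 * j + 1) g))"
      by simp
    with Suc.prems obtain \<alpha> \<beta> y where "\<alpha> \<in> \<Gamma>" "\<beta> \<in> \<Gamma>" "z = \<alpha> g \<otimes> (\<beta> g \<otimes> y)"
      "weighted_sum G \<Gamma> (replicate_mset (2 * j + 1) g) y"
      unfolding weighted_sum_add_mset by (metis weighted_sum_add_mset)
    with Suc.IH three[OF that(1)] show ?case by metis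
  qed
  have "weighted_sum G \<Gamma> S x" if sum: "weighted_sum G \<Gamma> (repeat_mset k S) x" and odd: "odd k" for S k x
    using sum
  proof (induction S arbitrary: x)
    case (add g S)
    then have "weighted_sum G \<Gamma> (replicate_mset k g + repeat_mset k S) x" by simp
    then obtain y z where *: "weighted_sum G \<Gamma> (replicate_mset k g) z" "weighted_sum G \<Gamma> (repeat_mset k S) y" "x = z \<otimes> y"
      unfolding weighted_sum_union by blast
    have "k \<noteq> 0" using odd by (cases k) auto
    then have g: "g \<in> carrier G" using weighted_sum_closed[OF *(1)] by (auto simp: free_abelian_monoid_def)
    obtain j where "k = 2 * j + 1" using odd by (elim oddE)
    then obtain \<delta> where "\<delta> \<in> \<Gamma>" "z = \<delta> g" using single[OF g] *(1) by blast
    then show ?case using add.IH[OF *(2)] g unfolding *(3) by (auto intro: weighted_sum.add)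
  qed simp
  then show ?thesis unfolding seminormal_iff weighted_zero_sum_iff by blast
qed

lemma seminormal_cancel_odd:
  assumes "seq_seminormal G B" "g \<in> carrier G" "odd k" "weighted_sum G \<Gamma> (replicate_mset k g) \<one>"
  shows "g = \<one>"
proof -
  have "{#g#} \<in> B" using assms unfolding seminormal_iff weighted_zero_sum_iff
    by (auto simp: free_abelian_monoid_def dest!: spec[of _ "{#g#}"])
  then obtain \<gamma> where "\<gamma> \<in> \<Gamma>" "\<gamma> g = \<one>"
    unfolding weighted_zero_sum_iff weighted_sum_single by metis
  then show ?thesis using weight_eq_one_iff[of \<gamma> g] assms(2) by simp
qed

lemma weighted_sum_replicate:
  assumes "g \<in> carrier G" shows "weighted_sum G \<Gamma> (replicate_mset k g) (g [^] k)"
proof (induction k)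
  case (Suc k)
  have "weighted_sum G \<Gamma> ({#g#} + replicate_mset k g) (g \<otimes> g [^] k)"
    unfolding weighted_sum_union using Suc weighted_sum_pm[OF assms] by blast
  then show ?case using assms by (simp add: m_comm)
qed simp

text \<open>Write the order of \<open>g\<close> as \<open>2 ^ a * m\<close> with \<open>m\<close> odd. Then \<open>m\<close> copies of \<open>2 ^ a g\<close> add up to zero without
any change of sign, and \<open>seminormal_cancel_odd\<close> forces \<open>2 ^ a g = 0\<close>.\<close>

lemma seminormal_imp_ord_power_2:
  assumes "finite (carrier G)" "seq_seminormal G B" "g \<in> carrier G" shows "\<exists>a. ord g = 2 ^ a"
proof -
  have "ord g \<noteq> 0" using ord_ge_1[OF assms(1,3)] by simp
  then obtain a m where m: "ord g = 2 ^ a * m" "odd m"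
    using multiplicity_decompose'[of "ord g" 2] by (metis not_is_unit_0 nat_dvd_1_iff_1 numeral_eq_one_iff semiring_norm(85) zero_neq_numeral)
  have "weighted_sum G \<Gamma> (replicate_mset m (g [^] (2 ^ a :: nat))) \<one>"
    using weighted_sum_replicate[of "g [^] (2 ^ a :: nat)" m] assms(3) m(1)
    by (simp add: nat_pow_pow) (metis pow_ord_eq_1)
  with seminormal_cancel_odd[OF assms(2) _ m(2)] assms(3) have "g [^] (2 ^ a :: nat) = \<one>" by simp
  then have "ord g dvd 2 ^ a" using assms(3) pow_eq_id by blast
  then show ?thesis using m(1) by (metis dvd_antisym dvd_triv_left)
qed

end

lemma (in group) group_exp_dvd_iff:
  "group_exp G dvd n \<longleftrightarrow> (\<forall>g\<in>carrier G. g [^] n = \<one>)"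
  by (auto simp: group_exp_def Lcm_dvd_iff pow_eq_id)

section \<open>Signs as weights\<close>

text \<open>The odd part of the exponent is coprime to all orders, so the part that is a power of 2 already kills
the group.\<close>

lemma (in group) group_exp_power_2:
  assumes fin: "finite (carrier G)" and ord: "\<And>g. g \<in> carrier G \<Longrightarrow> \<exists>a. ord g = 2 ^ a"
  shows "\<exists>k. group_exp G = 2 ^ k"
proof -
  have "group_exp G dvd order G" using pow_order_eq_1 by (simp add: group_exp_dvd_iff)
  moreover have "order G > 0" using fin by (simp add: order_gt_0_iff_finite)
  ultimately have "group_exp G \<noteq> 0" by auto
  then obtain k m where m: "group_exp G = 2 ^ k * m" "odd m"
    using multiplicity_decompose'[of "group_exp G" 2] by (metis not_is_unit_0 nat_dvd_1_iff_1 numeral_eq_one_iff semiring_norm(85) zero_neq_numeral)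
  have "g [^] (2 ^ k :: nat) = \<one>" if g: "g \<in> carrier G" for g
  proof -
    obtain a where a: "ord g = 2 ^ a" using ord[OF g] by blast
    have "(2 ^ a :: nat) dvd 2 ^ k * m"
      using m(1) g a group_exp_dvd_iff[of "group_exp G"] pow_eq_id[OF g, of "group_exp G"] by simp
    moreover have "coprime (2 ^ a :: nat) m" using m(2) by simp
    ultimately show ?thesis using a pow_eq_id[OF g] by (simp add: coprime_dvd_mult_left_iff)
  qed
  then have "group_exp G dvd 2 ^ k" by (simp add: group_exp_dvd_iff)
  with m(1) show ?thesis by (metis dvd_antisym dvd_triv_left)
qed

context comm_group
begin

lemma seq_sum_empty: "seq_sum G {#} = \<one>"
  by (simp add: seq_sum_def)

lemma seq_sum_closed: "S \<in> free_abelian_monoid G \<Longrightarrow> seq_sum G S \<in> carrier G"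
  by (auto simp: seq_sum_def free_abelian_monoid_def intro!: finprod_closed)

lemma seq_sum_union:
  assumes "S \<in> free_abelian_monoid G" "T \<in> free_abelian_monoid G"
  shows "seq_sum G (S + T) = seq_sum G S \<otimes> seq_sum G T"
  using assms(1)
proof (induction S)
  case empty
  then show ?case using seq_sum_closed[OF assms(2)] by (simp add: seq_sum_empty)
next
  case (add g S)
  then have g: "g \<in> carrier G" "S \<in> free_abelian_monoid G" by (auto simp: free_abelian_monoid_def)
  then show ?case
    using add.IH assms(2) seq_sum_closed[OF g(2)] seq_sum_closed[OF assms(2)]
    by (simp add: free_abelian_monoid_def seq_sum_add_mset m_ac)
qed

lemma double_set_mult:
  assumes "x \<in> double_set G" "y \<in> double_set G" shows "x \<otimes> y \<in> double_set G"
proof -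
  obtain a b where "a \<in> carrier G" "b \<in> carrier G" "x = a \<otimes> a" "y = b \<otimes> b"
    using assms by (auto simp: double_set_def)
  then have "x \<otimes> y = (a \<otimes> b) \<otimes> (a \<otimes> b)" "a \<otimes> b \<in> carrier G" by (simp_all add: m_ac)
  then show ?thesis unfolding double_set_def by blast
qed

lemma double_set_inv:
  assumes "x \<in> double_set G" shows "inv x \<in> double_set G"
proof -
  obtain a where "a \<in> carrier G" "x = a \<otimes> a" using assms by (auto simp: double_set_def)
  then have "inv x = inv a \<otimes> inv a" "inv a \<in> carrier G" by (simp_all add: inv_mult)
  then show ?thesis unfolding double_set_def by blast
qed

end

locale plus_minus = comm_group G for G (structure)

sublocale plus_minus \<subseteq> signed_weights G "plus_minus_id G"
  by unfold_locales (simp_all add: plus_minus_id_auto comm_group_axioms)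

context plus_minus
begin

lemma weight_cases:
  assumes "\<gamma> \<in> plus_minus_id G" "g \<in> carrier G" obtains "\<gamma> g = g" | "\<gamma> g = inv g"
  using assms by (auto simp: plus_minus_id_def)

text \<open>Replacing \<open>g\<close> by \<open>-g\<close> changes a sum by \<open>2 g\<close>, so all signed sums of a sequence agree modulo \<open>2G\<close>.\<close>

lemma weighted_sum_seq_sum:
  assumes "weighted_sum G (plus_minus_id G) S x" shows "seq_sum G S \<otimes> inv x \<in> double_set G"
  using assms
proof (induction rule: weighted_sum.induct)
  case empty
  have "\<one> = \<one> \<otimes> \<one>" by simp
  then show ?case unfolding double_set_def seq_sum_empty by force
next
  case (add S x \<gamma> g)
  have S: "S \<in> free_abelian_monoid G" "x \<in> carrier G" using weighted_sum_closed[OF add.hyps(1)] by auto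
  note c = seq_sum_closed[OF S(1)] S(2) add.hyps(3)
  have "seq_sum G (add_mset g S) \<otimes> inv (\<gamma> g \<otimes> x) = (seq_sum G S \<otimes> inv x) \<otimes> (g \<otimes> inv (\<gamma> g))"
    using S add.hyps c weight_closed[OF add.hyps(2,3)]
    by (simp add: free_abelian_monoid_def seq_sum_add_mset inv_mult m_ac)
  moreover have "g \<otimes> inv (\<gamma> g) \<in> double_set G"
  proof (rule weight_cases[OF add.hyps(2,3)])
    assume "\<gamma> g = g"
    then have "g \<otimes> inv (\<gamma> g) = \<one> \<otimes> \<one>" using c by simp
    then show ?thesis unfolding double_set_def by blast
  next
    assume "\<gamma> g = inv g"
    then have "g \<otimes> inv (\<gamma> g) = g \<otimes> g" using c by simp
    then show ?thesis unfolding double_set_def using c by blast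
  qed
  ultimately show ?case using double_set_mult[OF add.IH] by simp
qed

lemma weighted_sum_all_plus:
  "S \<in> free_abelian_monoid G \<Longrightarrow> weighted_sum G (plus_minus_id G) S (seq_sum G S)"
proof (induction S)
  case (add g S)
  then have g: "g \<in> carrier G" and S: "S \<in> free_abelian_monoid G" by (auto simp: free_abelian_monoid_def)
  have "weighted_sum G (plus_minus_id G) ({#g#} + S) (g \<otimes> seq_sum G S)"
    unfolding weighted_sum_union using weighted_sum_pm(1)[OF g] add.IH[OF S] by blast
  then show ?case using g S seq_sum_closed[OF S]
    by (simp add: free_abelian_monoid_def seq_sum_add_mset m_comm)
qed (simp add: seq_sum_empty)

text \<open>If \<open>\<sigma>(S) = 2 h\<close>, then \<open>S h h\<close> is in \<open>B\<close> with the sign \<open>-\<close> at both copies of \<open>h\<close>, and \<open>h h \<in> B\<close>.\<close>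

lemma closure_plus_minus:
  "seq_closure G B = frag_of_mset ` {S \<in> free_abelian_monoid G. seq_sum G S \<in> double_set G}"
proof -
  have B: "seq_sum G S \<in> double_set G" if "S \<in> B" for S
    using weighted_sum_seq_sum[of S \<one>] that seq_sum_closed[OF zero_sum_in_free_monoid[OF that]]
    by (simp add: weighted_zero_sum_iff)
  have "(\<exists>T\<in>B. S + T \<in> B) \<longleftrightarrow> seq_sum G S \<in> double_set G" if S: "S \<in> free_abelian_monoid G" for S
  proof
    assume "\<exists>T\<in>B. S + T \<in> B"
    then obtain T where T: "T \<in> B" "S + T \<in> B" by blast
    have c: "seq_sum G S \<in> carrier G" "seq_sum G T \<in> carrier G"
      using S T seq_sum_closed zero_sum_in_free_monoid by blast+
    have "seq_sum G S = seq_sum G (S + T) \<otimes> inv (seq_sum G T)"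
      unfolding seq_sum_union[OF S zero_sum_in_free_monoid[OF T(1)]] using c by (simp add: m_assoc)
    then show "seq_sum G S \<in> double_set G"
      using double_set_mult[OF B[OF T(2)] double_set_inv[OF B[OF T(1)]]] by simp
  next
    assume "seq_sum G S \<in> double_set G"
    then obtain h where h: "h \<in> carrier G" "seq_sum G S = h \<otimes> h" by (auto simp: double_set_def)
    have F: "{#h#} \<in> free_abelian_monoid G" using h by (simp add: free_abelian_monoid_def)
    have "weighted_sum G (plus_minus_id G) (S + ({#h#} + {#h#})) (seq_sum G S \<otimes> (inv h \<otimes> inv h))"
      unfolding weighted_sum_union using weighted_sum_all_plus[OF S] weighted_sum_pm(2)[OF h(1)] by blast
    moreover have "seq_sum G S \<otimes> (inv h \<otimes> inv h) = \<one>" using h by (simp add: m_assoc flip: inv_mult)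
    ultimately have "S + ({#h#} + {#h#}) \<in> B" by (simp add: weighted_zero_sum_iff)
    then show "\<exists>T\<in>B. S + T \<in> B" using zero_sum_double[OF F] by blast
  qed
  then show ?thesis unfolding closure_eq by blast
qed

text \<open>If \<open>4 g = 0\<close>, then \<open>3 g = -g\<close>, so \<open>{g, -g}\<close> is closed under sums of three elements. In the other
direction the sequence \<open>g f\<close> with \<open>f = 3 g\<close> is the witness: its cube is a zero-sum sequence
by \<open>g + g + g + f - f - f = 0\<close>, and a signed sum of \<open>g\<close> and \<open>f\<close> is \<open>\<plusminus>2 g\<close> or \<open>\<plusminus>4 g\<close>.\<close>

lemma seminormal_plus_minus: "seq_seminormal G B \<longleftrightarrow> (\<forall>g\<in>carrier G. g [^] (4::nat) = \<one>)"
proof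
  assume four: "\<forall>g\<in>carrier G. g [^] (4::nat) = \<one>"
  show "seq_seminormal G B"
  proof (rule seminormalI)
    fix g \<alpha> \<beta> \<gamma> assume g: "g \<in> carrier G"
      and w: "\<alpha> \<in> plus_minus_id G" "\<beta> \<in> plus_minus_id G" "\<gamma> \<in> plus_minus_id G"
    have pow4: "g \<otimes> (g \<otimes> (g \<otimes> g)) = \<one>" using four g by (simp add: numeral_eq_Suc m_assoc)
    have ggg: "g \<otimes> (g \<otimes> g) = inv g"
      by (rule sym, rule inv_equality) (use pow4 g in \<open>simp_all add: m_assoc\<close>)
    have iii: "inv g \<otimes> (inv g \<otimes> inv g) = g"
      using arg_cong[OF ggg, of "m_inv G"] g by (simp add: inv_mult)
    have c1: "g \<otimes> (inv g \<otimes> x) = x" "inv g \<otimes> (g \<otimes> x) = x" if "x \<in> carrier G" for x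
      using g that by (simp_all flip: m_assoc)
    have "\<alpha> g \<otimes> (\<beta> g \<otimes> \<gamma> g) \<in> {g, inv g}"
      by (rule weight_cases[OF w(1) g]; rule weight_cases[OF w(2) g]; rule weight_cases[OF w(3) g])
        (use g ggg iii c1 in simp_all)
    then have "weighted_sum G (plus_minus_id G) {#g#} (\<alpha> g \<otimes> (\<beta> g \<otimes> \<gamma> g))"
      using weighted_sum_pm[OF g] by auto
    then show "\<exists>\<delta>\<in>plus_minus_id G. \<alpha> g \<otimes> (\<beta> g \<otimes> \<gamma> g) = \<delta> g"
      by (simp add: weighted_sum_single)
  qed
next
  assume sn: "seq_seminormal G B"
  show "\<forall>g\<in>carrier G. g [^] (4::nat) = \<one>"
  proof
    fix g assume g: "g \<in> carrier G"
    define f where "f = g [^] (3::nat)"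
    have f: "f \<in> carrier G" using g by (simp add: f_def)
    have "weighted_sum G (plus_minus_id G) (replicate_mset 3 g + ({#f#} + ({#f#} + {#f#})))
        (f \<otimes> (f \<otimes> (inv f \<otimes> inv f)))"
      unfolding weighted_sum_union
      using weighted_sum_replicate[OF g, of 3] weighted_sum_pm[OF f] f_def by blast
    moreover have "f \<otimes> (f \<otimes> (inv f \<otimes> inv f)) = \<one>"
      using f by (simp add: m_assoc[symmetric] inv_solve_right)
    moreover have "replicate_mset 3 g + ({#f#} + ({#f#} + {#f#})) = repeat_mset 3 {#g, f#}"
      by (simp add: numeral_3_eq_3)
    ultimately have "repeat_mset 3 {#g, f#} \<in> B" unfolding weighted_zero_sum_iff by metis
    moreover have "{#g, f#} \<in> free_abelian_monoid G" using g f by (simp add: free_abelian_monoid_def)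
    moreover have "odd (3::nat)" by simp
    ultimately have "{#g, f#} \<in> B" using sn unfolding seminormal_iff by blast
    then obtain \<alpha> \<beta> where w: "\<alpha> \<in> plus_minus_id G" "\<beta> \<in> plus_minus_id G" "\<alpha> g \<otimes> \<beta> f = \<one>"
      unfolding weighted_zero_sum_iff weighted_sum_add_mset weighted_sum_single
      using weight_closed[of _ f] f by fastforce
    have four: "g \<otimes> f = g [^] (4::nat)" "f = g \<otimes> (g \<otimes> g)"
      using g by (simp_all add: f_def numeral_eq_Suc m_ac)
    show "g [^] (4::nat) = \<one>"
    proof (rule weight_cases[OF w(1) g]; rule weight_cases[OF w(2) f])
      assume "\<alpha> g = g" "\<beta> f = f"
      then show ?thesis using w(3) four by simp
    next
      assume "\<alpha> g = inv g" "\<beta> f = inv f"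
      then have "inv (g \<otimes> f) = \<one>" using w(3) g f by (simp add: inv_mult)
      then show ?thesis using four(1) g f by (metis inv_inv inv_one m_closed)
    next
      assume "\<alpha> g = g" "\<beta> f = inv f"
      then have "g = f" using w(3) g f by (metis inv_equality inv_inv inv_closed)
      then have "g \<otimes> g = \<one>" using four(2) g by (metis l_cancel_one' m_closed r_cancel_one')
      then show ?thesis using four(1) \<open>g = f\<close> by simp
    next
      assume "\<alpha> g = inv g" "\<beta> f = f"
      then have "g = f" using w(3) g f by (metis inv_comm inv_equality inv_inv inv_closed)
      then have "g \<otimes> g = \<one>" using four(2) g by (metis l_cancel_one' m_closed r_cancel_one')
      then show ?thesis using four(1) \<open>g = f\<close> by simp
    qed
  qed
qed

end

section \<open>Cyclic summands of maximal order in finite abelian 2-groups\<close>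

context comm_group
begin

lemma ord_eq_power_2:
  assumes "x \<in> carrier G" "x [^] (2 ^ Suc t :: nat) = \<one>" "x [^] (2 ^ t :: nat) \<noteq> \<one>"
  shows "ord x = 2 ^ Suc t"
proof -
  have "ord x dvd 2 ^ Suc t" using assms pow_eq_id by blast
  then obtain i where i: "i \<le> Suc t" "ord x = 2 ^ i"
    using divides_primepow_nat[of 2 "ord x" "Suc t"] by auto
  have "\<not> ord x dvd 2 ^ t" using assms pow_eq_id by blast
  then have "\<not> i \<le> t" using i(2) le_imp_power_dvd[of i t 2] by auto
  then show ?thesis using i by (simp add: le_Suc_eq)
qed

lemma subgroup_comm_group:
  assumes H: "subgroup H G" shows "comm_group (G\<lparr>carrier := H\<rparr>)"
  by (rule group.group_comm_groupI[OF subgroup_imp_group[OF H]])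
    (simp add: m_comm subgroup.mem_carrier[OF H])

lemma auto_closed: "\<alpha> \<in> auto G \<Longrightarrow> x \<in> carrier G \<Longrightarrow> \<alpha> x \<in> carrier G"
  by (auto simp: auto_def hom_def)

lemma auto_mult: "\<alpha> \<in> auto G \<Longrightarrow> x \<in> carrier G \<Longrightarrow> y \<in> carrier G \<Longrightarrow> \<alpha> (x \<otimes> y) = \<alpha> x \<otimes> \<alpha> y"
  by (auto simp: auto_def hom_def)

lemma auto_inj: "\<alpha> \<in> auto G \<Longrightarrow> x \<in> carrier G \<Longrightarrow> y \<in> carrier G \<Longrightarrow> \<alpha> x = \<alpha> y \<Longrightarrow> x = y"
  by (auto simp: auto_def Bij_def bij_betw_def inj_on_def)

lemma auto_one: "\<alpha> \<in> auto G \<Longrightarrow> \<alpha> \<one> = \<one>"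
  using hom_one[of \<alpha> G G] by (auto simp: auto_def)

lemma auto_pow: "\<alpha> \<in> auto G \<Longrightarrow> x \<in> carrier G \<Longrightarrow> \<alpha> (x [^] (n::nat)) = \<alpha> x [^] n"
  by (induction n) (auto simp: auto_one auto_mult)

text \<open>On a finite group an injective endomorphism is bijective.\<close>

lemma auto_of_hom:
  assumes "finite (carrier G)" "\<theta> \<in> hom G G" "\<And>x. x \<in> carrier G \<Longrightarrow> \<theta> x = \<one> \<Longrightarrow> x = \<one>"
  shows "restrict \<theta> (carrier G) \<in> auto G"
proof -
  interpret group_hom G G \<theta> using assms(2) by unfold_locales
  have "inj_on \<theta> (carrier G)" using assms(3) by (simp add: inj_on_one_iff)
  moreover have "\<theta> ` carrier G \<subseteq> carrier G" by auto
  ultimately have "bij_betw \<theta> (carrier G) (carrier G)"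
    using assms(1) by (simp add: bij_betw_def endo_inj_surj)
  then have "bij_betw (restrict \<theta> (carrier G)) (carrier G) (carrier G)"
    by (simp cong: bij_betw_cong)
  moreover have "restrict \<theta> (carrier G) \<in> hom G G" using assms(2) by (auto simp: hom_def)
  ultimately show ?thesis by (simp add: auto_def Bij_def)
qed

lemma auto_inverse:
  assumes "\<alpha> \<in> auto G" shows "\<exists>\<beta>\<in>auto G. \<forall>x\<in>carrier G. \<beta> (\<alpha> x) = x"
proof (rule bexI)
  show "restrict (inv_into (carrier G) \<alpha>) (carrier G) \<in> auto G"
    using assms by (simp add: auto_def restrict_inv_into_hom restrict_inv_into_Bij)
  show "\<forall>x\<in>carrier G. restrict (inv_into (carrier G) \<alpha>) (carrier G) (\<alpha> x) = x"
  proof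
    fix x assume "x \<in> carrier G"
    moreover have "inj_on \<alpha> (carrier G)" using assms by (simp add: auto_def Bij_def bij_betw_def)
    ultimately show "restrict (inv_into (carrier G) \<alpha>) (carrier G) (\<alpha> x) = x"
      using auto_closed[OF assms] by simp
  qed
qed

lemma auto_compose:
  assumes "\<alpha> \<in> auto G" "\<beta> \<in> auto G" shows "compose (carrier G) \<alpha> \<beta> \<in> auto G"
  using assms by (auto simp: auto_def hom_compose compose_Bij)

text \<open>The group is the direct sum of the cyclic group spanned by \<open>e\<close> and of \<open>H\<close>, in the form in which
elements are decomposed below: with natural number multiples of \<open>e\<close>.\<close>

definition cyclic_complement :: "'a \<Rightarrow> 'a set \<Rightarrow> bool" where
  "cyclic_complement e H \<longleftrightarrow> e \<in> carrier G \<and> subgroup H G \<and>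
     (\<forall>n::nat. e [^] n \<in> H \<longrightarrow> e [^] n = \<one>) \<and> (\<forall>x\<in>carrier G. \<exists>n::nat. \<exists>h\<in>H. x = e [^] n \<otimes> h)"

text \<open>A subgroup \<open>H\<close> that is maximal among those meeting the span of \<open>e\<close> trivially is a complement. Otherwise
some \<open>z\<close> lies outside \<open>A = \<langle>e\<rangle> + H\<close> while \<open>2 z = n e + h\<close> lies inside. Multiplication by half the
exponent shows that \<open>n\<close> is even, because \<open>e\<close> has maximal order. Then \<open>y = z - (n / 2) e\<close> satisfies
\<open>2 y \<in> H\<close>, and \<open>H \<union> (y + H)\<close> contradicts the maximality of \<open>H\<close>.\<close>

lemma cyclic_complement_exists:
  assumes fin: "finite (carrier G)" and exp: "\<And>x. x \<in> carrier G \<Longrightarrow> x [^] (2 ^ t :: nat) = \<one>"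
    and e: "e \<in> carrier G" "ord e = 2 ^ t"
  shows "\<exists>H. cyclic_complement e H"
proof -
  define F where "F = {H. subgroup H G \<and> (\<forall>n::nat. e [^] n \<in> H \<longrightarrow> e [^] n = \<one>)}"
  have "F \<subseteq> Pow (carrier G)" by (auto simp: F_def dest: subgroup.subset)
  then have "finite F" using fin by (simp add: finite_subset)
  moreover have "{\<one>} \<in> F" by (simp add: F_def triv_subgroup)
  ultimately obtain H where H: "H \<in> F" and max: "\<And>H'. H' \<in> F \<Longrightarrow> H \<subseteq> H' \<Longrightarrow> H = H'"
    using finite_has_maximal[of F] by blast
  interpret H: subgroup H G using H by (simp add: F_def)
  have triv: "e [^] n = \<one>" if "e [^] n \<in> H" for n :: nat using H that by (simp add: F_def)
  define A where "A = {e [^] n \<otimes> h | n h. h \<in> H \<and> n \<in> (UNIV :: nat set)}"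
  have A_I: "e [^] n \<otimes> h \<in> A" if "h \<in> H" for n :: nat and h
    using that by (auto simp: A_def)
  have "\<one> \<in> A" using A_I[of \<one> 0] by simp
  have "x \<in> A" if x: "x \<in> carrier G" for x
  proof (rule ccontr)
    assume "x \<notin> A"
    define k where "k = (LEAST k. x [^] (2 ^ k :: nat) \<in> A)"
    have k: "x [^] (2 ^ k :: nat) \<in> A" unfolding k_def
      by (rule LeastI[of _ t]) (simp add: exp[OF x] \<open>\<one> \<in> A\<close>)
    have least: "x [^] (2 ^ j :: nat) \<notin> A" if "j < k" for j
      using not_less_Least that unfolding k_def by blast
    have "k \<noteq> 0" using k x \<open>x \<notin> A\<close> by (intro notI) simp
    then obtain j where j: "k = Suc j" by (cases k) auto
    define z where "z = x [^] (2 ^ j :: nat)"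
    have z: "z \<in> carrier G" "z \<notin> A" using x least j by (auto simp: z_def)
    have "z \<otimes> z \<in> A" using k x unfolding z_def j by (simp add: nat_pow_mult mult_2)
    then obtain n h where h: "h \<in> H" "z \<otimes> z = e [^] (n::nat) \<otimes> h" by (auto simp: A_def)
    note c = e(1) z(1) H.mem_carrier
    have "t \<noteq> 0" using exp[OF z(1)] z \<open>\<one> \<in> A\<close> by (intro notI) simp
    then obtain s where s: "t = Suc s" by (cases t) auto
    have "e [^] (n * 2 ^ s) \<otimes> h [^] (2 ^ s :: nat) = (z \<otimes> z) [^] (2 ^ s :: nat)"
      using c h by (simp add: nat_pow_distrib nat_pow_pow)
    also have "\<dots> = z [^] (2 ^ t :: nat)" using c unfolding s
      by (simp add: nat_pow_distrib nat_pow_mult mult_2)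
    also have "\<dots> = \<one>" by (rule exp[OF z(1)])
    finally have "e [^] (n * 2 ^ s) = inv (h [^] (2 ^ s :: nat))"
      using c h by (simp add: inv_equality)
    moreover have "h [^] m \<in> H" for m :: nat by (induction m) (simp_all add: h(1))
    ultimately have "e [^] (n * 2 ^ s) \<in> H" by simp
    then have "e [^] (n * 2 ^ s) = \<one>" by (rule triv)
    then have "2 ^ Suc s dvd n * 2 ^ s" using pow_eq_id[OF e(1)] e(2) s by simp
    then obtain m where m: "n = 2 * m" by auto
    define y where "y = z \<otimes> inv (e [^] m)"
    have y: "y \<in> carrier G" using c by (simp add: y_def)
    have zy: "z = e [^] m \<otimes> y" using c by (simp add: y_def m_lcomm)
    have "e [^] n = e [^] m \<otimes> e [^] m" using c by (simp add: m nat_pow_mult mult_2)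
    then have "e [^] n \<otimes> (y \<otimes> y) = z \<otimes> z" unfolding zy using c y by (simp add: m_ac)
    then have "y \<otimes> y = h" using h c y by simp
    then have yy: "y \<otimes> y \<in> H" using h by simp
    have yH: "y \<notin> H" using A_I[of y m] zy z by blast
    define H' where "H' = {w. w \<in> H \<or> (\<exists>h\<in>H. w = y \<otimes> h)}"
    have "subgroup H' G"
    proof (rule subgroupI)
      show "H' \<subseteq> carrier G" using y by (auto simp: H'_def)
      have "\<one> \<in> H'" by (simp add: H'_def)
      then show "H' \<noteq> {}" by blast
      have inv_y: "inv (y \<otimes> h) = y \<otimes> (inv (y \<otimes> y) \<otimes> inv h)" if "h \<in> H" for h
        using that y by (simp add: inv_mult flip: m_assoc)
      have H'_I: "a \<in> H \<Longrightarrow> a \<in> H'" "a \<in> H \<Longrightarrow> y \<otimes> a \<in> H'" for a by (auto simp: H'_def)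
      have H'_E: "a \<in> H \<or> (\<exists>b\<in>H. a = y \<otimes> b)" if "a \<in> H'" for a using that by (simp add: H'_def)
      show "inv w \<in> H'" if w: "w \<in> H'" for w
      proof -
        consider "w \<in> H" | h where "h \<in> H" "w = y \<otimes> h" using H'_E[OF w] by blast
        then show ?thesis
        proof cases
          case 2
          then show ?thesis unfolding 2(2) inv_y[OF 2(1)] using yy by (intro H'_I) simp
        qed (simp add: H'_I)
      qed
      have c1: "(y \<otimes> a) \<otimes> b = y \<otimes> (a \<otimes> b)" "a \<otimes> (y \<otimes> b) = y \<otimes> (a \<otimes> b)"
        "(y \<otimes> a) \<otimes> (y \<otimes> b) = (y \<otimes> y) \<otimes> (a \<otimes> b)" if "a \<in> H" "b \<in> H" for a b
        using that y by (simp_all add: m_ac)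
      show "v \<otimes> w \<in> H'" if v: "v \<in> H'" and w: "w \<in> H'" for v w
      proof -
        consider "v \<in> H" | a where "a \<in> H" "v = y \<otimes> a" using H'_E[OF v] by blast
        then show ?thesis
        proof cases
          case v: 1
          consider "w \<in> H" | b where "b \<in> H" "w = y \<otimes> b" using H'_E[OF w] by blast
          then show ?thesis by cases (use v c1(2)[of v] H'_I in simp_all)
        next
          case v: 2
          consider "w \<in> H" | b where "b \<in> H" "w = y \<otimes> b" using H'_E[OF w] by blast
          then show ?thesis by cases (use v c1(1)[of a w] c1(3)[of a] yy H'_I in simp_all)
        qed
      qed
    qed
    moreover have "e [^] i = \<one>" if i: "e [^] i \<in> H'" for i :: nat
    proof (cases "e [^] i \<in> H")
      case False
      then obtain h' where h': "h' \<in> H" "e [^] i = y \<otimes> h'" using i by (auto simp: H'_def)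
      then have "y = e [^] i \<otimes> inv h'" using y by (simp add: m_assoc)
      then have "z = e [^] m \<otimes> (e [^] i \<otimes> inv h')" using zy by simp
      then have "z = e [^] (m + i) \<otimes> inv h'" using c h'(1) by (simp add: m_assoc flip: nat_pow_mult)
      then show ?thesis using z(2) A_I[of "inv h'"] h'(1) by simp
    qed (rule triv)
    ultimately have "H' \<in> F" by (simp add: F_def)
    then have "H = H'" by (rule max) (auto simp: H'_def)
    moreover have "y \<in> H'" using y by (auto simp: H'_def intro!: bexI[of _ \<one>])
    ultimately show False using yH by simp
  qed
  then have "cyclic_complement e H"
    using e(1) triv H.subgroup_axioms by (auto simp: cyclic_complement_def A_def)
  then show ?thesis by blast
qed

lemma cyclic_complement_unique:
  assumes "cyclic_complement e H" "h \<in> H" "h' \<in> H" "e [^] (n::nat) \<otimes> h = e [^] (m::nat) \<otimes> h'"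
  shows "h = h' \<and> n mod ord e = m mod ord e"
proof -
  interpret H: subgroup H G using assms by (simp add: cyclic_complement_def)
  have e: "e \<in> carrier G" using assms by (simp add: cyclic_complement_def)
  have wlog: "h = h' \<and> n mod ord e = m mod ord e"
    if "n \<le> m" "h \<in> H" "h' \<in> H" "e [^] n \<otimes> h = e [^] m \<otimes> h'" for n m :: nat and h h'
  proof -
    have "e [^] n \<otimes> h = e [^] n \<otimes> (e [^] (m - n) \<otimes> h')"
      using that e by (simp add: nat_pow_mult flip: m_assoc)
    then have h: "h = e [^] (m - n) \<otimes> h'" using that e by simp
    then have "e [^] (m - n) = h \<otimes> inv h'" using that e by (simp add: m_assoc)
    then have "e [^] (m - n) \<in> H" using that by simp
    then have 1: "e [^] (m - n) = \<one>" using assms(1) by (simp add: cyclic_complement_def)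
    then have "ord e dvd m - n" using e pow_eq_id by blast
    then have "m mod ord e = n mod ord e" using mod_eq_dvd_iff_nat[OF \<open>n \<le> m\<close>] by simp
    then show ?thesis using h 1 that by simp
  qed
  show ?thesis
  proof (cases "n \<le> m")
    case True
    then show ?thesis using wlog assms by blast
  next
    case False
    then have "h' = h \<and> m mod ord e = n mod ord e" using wlog[of m n h' h] assms by simp
    then show ?thesis by simp
  qed
qed

text \<open>A homomorphism on the direct sum is prescribed by its values on the two summands; the image of \<open>e\<close> only
has to be killed by the order of \<open>e\<close>.\<close>

lemma cyclic_complement_hom:
  fixes K (structure)
  assumes comp: "cyclic_complement e H" and "comm_group K"
    and \<eta>: "\<eta> \<in> hom (G\<lparr>carrier := H\<rparr>) K" and f: "f \<in> carrier K" "f [^]\<^bsub>K\<^esub> ord e = \<one>\<^bsub>K\<^esub>"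
  shows "\<exists>\<theta>\<in>hom G K. \<forall>n::nat. \<forall>h\<in>H. \<theta> (e [^]\<^bsub>G\<^esub> n \<otimes>\<^bsub>G\<^esub> h) = f [^]\<^bsub>K\<^esub> n \<otimes>\<^bsub>K\<^esub> \<eta> h"
proof -
  interpret K: comm_group K by fact
  interpret H: subgroup H G using comp by (simp add: cyclic_complement_def)
  have e: "e \<in> carrier G" using comp by (simp add: cyclic_complement_def)
  define \<theta> where "\<theta> x = (THE y. \<exists>n::nat. \<exists>h\<in>H. x = e [^]\<^bsub>G\<^esub> n \<otimes>\<^bsub>G\<^esub> h \<and> y = f [^]\<^bsub>K\<^esub> n \<otimes>\<^bsub>K\<^esub> \<eta> h)" for x
  have \<theta>: "\<theta> (e [^]\<^bsub>G\<^esub> n \<otimes>\<^bsub>G\<^esub> h) = f [^]\<^bsub>K\<^esub> n \<otimes>\<^bsub>K\<^esub> \<eta> h" if h: "h \<in> H" for n :: nat and h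
  proof -
    have "f [^]\<^bsub>K\<^esub> n = f [^]\<^bsub>K\<^esub> (n mod ord e)" for n
    proof -
      have "f [^]\<^bsub>K\<^esub> n = (f [^]\<^bsub>K\<^esub> ord e) [^]\<^bsub>K\<^esub> (n div ord e) \<otimes>\<^bsub>K\<^esub> f [^]\<^bsub>K\<^esub> (n mod ord e)"
        using f(1) by (simp add: K.nat_pow_pow K.nat_pow_mult)
      then show ?thesis using f by simp
    qed
    then have f_pow: "f [^]\<^bsub>K\<^esub> n = f [^]\<^bsub>K\<^esub> m" if "n mod ord e = m mod ord e" for n m
      using that by metis
    show ?thesis unfolding \<theta>_def
    proof (rule the_equality)
      fix y assume "\<exists>m::nat. \<exists>h'\<in>H. e [^]\<^bsub>G\<^esub> n \<otimes>\<^bsub>G\<^esub> h = e [^]\<^bsub>G\<^esub> m \<otimes>\<^bsub>G\<^esub> h' \<and> y = f [^]\<^bsub>K\<^esub> m \<otimes>\<^bsub>K\<^esub> \<eta> h'"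
      then obtain m :: nat and h' where *: "h' \<in> H" "e [^]\<^bsub>G\<^esub> n \<otimes>\<^bsub>G\<^esub> h = e [^]\<^bsub>G\<^esub> m \<otimes>\<^bsub>G\<^esub> h'"
        "y = f [^]\<^bsub>K\<^esub> m \<otimes>\<^bsub>K\<^esub> \<eta> h'" by blast
      then show "y = f [^]\<^bsub>K\<^esub> n \<otimes>\<^bsub>K\<^esub> \<eta> h"
        using cyclic_complement_unique[OF comp h *(1,2)] f_pow[of n m] by simp
    qed (use h in blast)
  qed
  have \<eta>c: "\<eta> h \<in> carrier K" if "h \<in> H" for h using \<eta> that by (auto simp: hom_def)
  have hom: "\<theta> \<in> hom G K"
  proof (rule homI)
    fix x assume "x \<in> carrier G"
    then obtain n :: nat and h where h: "h \<in> H" "x = e [^]\<^bsub>G\<^esub> n \<otimes>\<^bsub>G\<^esub> h"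
      using comp by (force simp: cyclic_complement_def)
    then show "\<theta> x \<in> carrier K" using \<theta>[OF h(1), of n] \<eta>c f by simp
    fix y assume "y \<in> carrier G"
    then obtain m :: nat and h' where h': "h' \<in> H" "y = e [^]\<^bsub>G\<^esub> m \<otimes>\<^bsub>G\<^esub> h'"
      using comp by (force simp: cyclic_complement_def)
    have "x \<otimes>\<^bsub>G\<^esub> y = e [^]\<^bsub>G\<^esub> (n + m) \<otimes>\<^bsub>G\<^esub> (h \<otimes>\<^bsub>G\<^esub> h')"
      using e h h' by (simp add: m_ac flip: nat_pow_mult)
    then have "\<theta> (x \<otimes>\<^bsub>G\<^esub> y) = f [^]\<^bsub>K\<^esub> (n + m) \<otimes>\<^bsub>K\<^esub> \<eta> (h \<otimes>\<^bsub>G\<^esub> h')"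
      using \<theta>[of "h \<otimes>\<^bsub>G\<^esub> h'" "n + m"] h h' by simp
    also have "\<eta> (h \<otimes>\<^bsub>G\<^esub> h') = \<eta> h \<otimes>\<^bsub>K\<^esub> \<eta> h'" using \<eta> h h' by (auto simp: hom_def)
    also have "f [^]\<^bsub>K\<^esub> (n + m) \<otimes>\<^bsub>K\<^esub> (\<eta> h \<otimes>\<^bsub>K\<^esub> \<eta> h') = \<theta> x \<otimes>\<^bsub>K\<^esub> \<theta> y"
      unfolding h h' \<theta>[OF h(1)] \<theta>[OF h'(1)] using f \<eta>c h h'
      by (simp add: K.m_ac flip: K.nat_pow_mult)
    finally show "\<theta> (x \<otimes>\<^bsub>G\<^esub> y) = \<theta> x \<otimes>\<^bsub>K\<^esub> \<theta> y" .
  qed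
  show ?thesis by (rule bexI[OF _ hom]) (simp add: \<theta>)
qed

lemma cyclic_complement_auto:
  assumes fin: "finite (carrier G)" and comp: "cyclic_complement e H"
    and \<eta>: "\<eta> \<in> hom (G\<lparr>carrier := H\<rparr>) G" and f: "f \<in> carrier G" "f [^] ord e = \<one>"
    and inj: "\<And>n::nat. \<And>h. h \<in> H \<Longrightarrow> f [^] n \<otimes> \<eta> h = \<one> \<Longrightarrow> e [^] n = \<one> \<and> h = \<one>"
  shows "\<exists>\<theta>\<in>auto G. \<forall>n::nat. \<forall>h\<in>H. \<theta> (e [^] n \<otimes> h) = f [^] n \<otimes> \<eta> h"
proof -
  obtain \<theta> where \<theta>: "\<theta> \<in> hom G G" "\<forall>n::nat. \<forall>h\<in>H. \<theta> (e [^] n \<otimes> h) = f [^] n \<otimes> \<eta> h"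
    using cyclic_complement_hom[OF comp comm_group_axioms \<eta> f] ..
  have eH: "e \<in> carrier G" "H \<subseteq> carrier G" using comp by (auto simp: cyclic_complement_def dest: subgroup.subset)
  have "restrict \<theta> (carrier G) \<in> auto G"
  proof (rule auto_of_hom[OF fin \<theta>(1)])
    fix x assume x: "x \<in> carrier G" "\<theta> x = \<one>"
    then obtain n :: nat and h where h: "h \<in> H" "x = e [^] n \<otimes> h"
      using comp by (force simp: cyclic_complement_def)
    then show "x = \<one>" using inj[OF h(1), of n] \<theta>(2) x by simp
  qed
  moreover have "restrict \<theta> (carrier G) (e [^] n \<otimes> h) = f [^] n \<otimes> \<eta> h" if "h \<in> H" for n :: nat and h
    using \<theta>(2) that eH by auto
  ultimately show ?thesis by (intro bexI[of _ "restrict \<theta> (carrier G)"]) simp_all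
qed

definition auto_orbit :: "'a \<Rightarrow> 'a set" where
  "auto_orbit x = (\<lambda>\<gamma>. \<gamma> x) ` auto G"

lemma auto_orbitE: "y \<in> auto_orbit x \<Longrightarrow> \<exists>\<gamma>\<in>auto G. \<gamma> x = y"
proof -
  assume "y \<in> auto_orbit x"
  then obtain \<gamma> where "y = \<gamma> x" "\<gamma> \<in> auto G" unfolding auto_orbit_def by (rule imageE)
  then show ?thesis by (intro bexI[of _ \<gamma>]) simp_all
qed

lemma auto_orbit_back:
  assumes "w \<in> auto_orbit x" "w \<in> auto_orbit y" "x \<in> carrier G" "y \<in> carrier G"
  shows "y \<in> auto_orbit x"
proof -
  obtain \<alpha> where \<alpha>: "\<alpha> \<in> auto G" "\<alpha> x = w" using auto_orbitE[OF assms(1)] ..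
  obtain \<beta> where \<beta>: "\<beta> \<in> auto G" "\<beta> y = w" using auto_orbitE[OF assms(2)] ..
  obtain \<gamma> where \<gamma>: "\<gamma> \<in> auto G" "\<forall>x\<in>carrier G. \<gamma> (\<beta> x) = x" using auto_inverse[OF \<beta>(1)] ..
  have "y = compose (carrier G) \<gamma> \<alpha> x"
    using assms(3) \<alpha>(2) \<beta>(2) \<gamma>(2)[rule_format, OF assms(4)] by (simp add: compose_def)
  then show ?thesis unfolding auto_orbit_def by (rule image_eqI[OF _ auto_compose[OF \<gamma>(1) \<alpha>(1)]])
qed

lemma auto_orbit_refl: "x \<in> carrier G \<Longrightarrow> x \<in> auto_orbit x"
  unfolding auto_orbit_def by (rule image_eqI[OF _ id_in_auto]) simp

text \<open>For odd \<open>u\<close> the map \<open>n e + h \<mapsto> n f + h\<close> with \<open>f = u e + h0\<close> is injective, as \<open>u\<close> is invertible modulo the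
order of \<open>e\<close>.\<close>

lemma orbit_of_odd_multiple:
  assumes fin: "finite (carrier G)" and comp: "cyclic_complement e H" and e: "ord e = 2 ^ t"
    and h0: "h0 \<in> H" and u: "odd u" and f: "f = e [^] (u::nat) \<otimes> h0" "f [^] (2 ^ t :: nat) = \<one>"
  shows "f \<in> auto_orbit e"
proof -
  interpret H: subgroup H G using comp by (simp add: cyclic_complement_def)
  have ec: "e \<in> carrier G" and triv: "\<And>n::nat. e [^] n \<in> H \<Longrightarrow> e [^] n = \<one>"
    using comp by (auto simp: cyclic_complement_def)
  have fc: "f \<in> carrier G" using f h0 ec by simp
  have ident: "(\<lambda>x. x) \<in> hom (G\<lparr>carrier := H\<rparr>) G" by (auto simp: hom_def)
  have inj: "e [^] n = \<one> \<and> h = \<one>" if h: "h \<in> H" and eq: "f [^] n \<otimes> h = \<one>" for n :: nat and h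
  proof -
    have "e [^] (u * n) \<otimes> (h0 [^] n \<otimes> h) = \<one>"
      using eq ec h0 h unfolding f(1) by (simp add: nat_pow_distrib nat_pow_pow m_assoc)
    then have "e [^] (u * n) = inv (h0 [^] n \<otimes> h)" using ec h0 h by (simp add: inv_equality)
    moreover have "h0 [^] n \<in> H" by (induction n) (simp_all add: h0)
    ultimately have "e [^] (u * n) \<in> H" using h by simp
    then have "2 ^ t dvd u * n" using triv pow_eq_id[OF ec] e by simp
    moreover have "coprime (2 ^ t) u" using u by simp
    ultimately have n: "2 ^ t dvd n" by (simp add: coprime_dvd_mult_right_iff)
    then obtain k where k: "n = 2 ^ t * k" by (elim dvdE)
    have "f [^] n = \<one>" unfolding k using fc f(2) by (simp flip: nat_pow_pow)
    moreover have "e [^] n = \<one>" using n pow_eq_id[OF ec] e by simp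
    ultimately show ?thesis using eq h by simp
  qed
  obtain \<gamma> where \<gamma>: "\<gamma> \<in> auto G" "\<forall>n::nat. \<forall>h\<in>H. \<gamma> (e [^] n \<otimes> h) = f [^] n \<otimes> h"
    using cyclic_complement_auto[OF fin comp ident fc f(2)[folded e] inj] ..
  have "f = \<gamma> e" using \<gamma>(2)[rule_format, of \<one> 1] ec fc by simp
  then show ?thesis unfolding auto_orbit_def using \<gamma>(1) by (rule image_eqI)
qed

text \<open>Decompose \<open>f = u e + h\<close> along a complement of \<open>e\<close>. One of \<open>u\<close> and \<open>u + 1\<close> is odd, so \<open>f\<close> or \<open>e + f\<close> is in the
orbit of \<open>e\<close>. In the same way \<open>e\<close> or \<open>e + f\<close> is in the orbit of \<open>f\<close>. In every case the orbits meet.\<close>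

lemma auto_transitive_max_order:
  assumes fin: "finite (carrier G)" and exp: "\<And>x. x \<in> carrier G \<Longrightarrow> x [^] (2 ^ t :: nat) = \<one>"
    and e: "e \<in> carrier G" "ord e = 2 ^ t" and f: "f \<in> carrier G" "ord f = 2 ^ t"
  shows "f \<in> auto_orbit e"
proof -
  have reach: "f \<in> auto_orbit e \<or> e \<otimes> f \<in> auto_orbit e"
    if e: "e \<in> carrier G" "ord e = 2 ^ t" and f: "f \<in> carrier G" for e f
  proof -
    obtain H where H: "cyclic_complement e H" using cyclic_complement_exists[OF fin exp e] by blast
    then obtain u :: nat and h where h: "h \<in> H" "f = e [^] u \<otimes> h"
      using f by (force simp: cyclic_complement_def)
    have hc: "h \<in> carrier G" using h H by (auto simp: cyclic_complement_def dest: subgroup.subset)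
    have ef: "e \<otimes> f = e [^] Suc u \<otimes> h" unfolding h(2) using e hc by (simp add: m_ac)
    show ?thesis
    proof (cases "even u")
      case True
      have "e \<otimes> f \<in> auto_orbit e"
        by (rule orbit_of_odd_multiple[OF fin H e(2) h(1) _ ef]) (use True exp e f in simp_all)
      then show ?thesis ..
    next
      case False
      have "f \<in> auto_orbit e" by (rule orbit_of_odd_multiple[OF fin H e(2) h(1) False h(2) exp[OF f]])
      then show ?thesis ..
    qed
  qed
  (* The remaining case \<open>f \<in> auto_orbit e\<close> is the claim itself. *)
  from reach[OF e f(1)] show ?thesis
  proof
    assume 1: "e \<otimes> f \<in> auto_orbit e"
    from reach[OF f e(1)] show ?thesis
    proof
      assume "e \<in> auto_orbit f"
      then show ?thesis using auto_orbit_back[OF auto_orbit_refl] e f by blast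
    next
      assume "f \<otimes> e \<in> auto_orbit f"
      then show ?thesis using auto_orbit_back[OF 1] m_comm e f by simp
    qed
  qed
qed

text \<open>For the weights \<open>Aut(G)\<close> this says that no cube of a single nonzero element is a zero-sum sequence.\<close>

definition three_free :: bool where
  "three_free \<longleftrightarrow> (\<forall>\<alpha>\<in>auto G. \<forall>\<beta>\<in>auto G. \<forall>\<gamma>\<in>auto G. \<forall>g\<in>carrier G.
     \<alpha> g \<otimes> (\<beta> g \<otimes> \<gamma> g) = \<one> \<longrightarrow> g = \<one>)"

text \<open>A counterexample \<open>f\<close> would have the same maximal order as \<open>e\<close>, and so would \<open>-(e + f)\<close>. All three are
then images of \<open>e\<close> under automorphisms, and they add up to zero.\<close>

lemma three_free_complement_exponent:
  assumes fin: "finite (carrier G)" and three_free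
    and exp: "\<And>x. x \<in> carrier G \<Longrightarrow> x [^] (2 ^ Suc t :: nat) = \<one>"
    and comp: "cyclic_complement e H" "ord e = 2 ^ Suc t" and f: "f \<in> H"
  shows "f [^] (2 ^ t :: nat) = \<one>"
proof (rule ccontr)
  assume ne: "f [^] (2 ^ t :: nat) \<noteq> \<one>"
  interpret H: subgroup H G using comp by (simp add: cyclic_complement_def)
  have ec: "e \<in> carrier G" using comp by (simp add: cyclic_complement_def)
  have fc: "f \<in> carrier G" using f by simp
  have fo: "ord f = 2 ^ Suc t" using ord_eq_power_2[OF fc exp[OF fc] ne] .
  have "(e \<otimes> f) [^] (2 ^ t :: nat) \<noteq> \<one>"
  proof
    assume "(e \<otimes> f) [^] (2 ^ t :: nat) = \<one>"
    then have "e [^] (2 ^ t :: nat) \<otimes> f [^] (2 ^ t :: nat) = e [^] (0 :: nat) \<otimes> \<one>"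
      using ec fc by (simp add: nat_pow_distrib)
    moreover have "f [^] n \<in> H" for n :: nat by (induction n) (simp_all add: f)
    ultimately show False using cyclic_complement_unique[OF comp(1) _ H.one_closed] ne by blast
  qed
  then have "ord (e \<otimes> f) = 2 ^ Suc t" using ord_eq_power_2[of "e \<otimes> f" t] exp ec fc by simp
  then have "ord (inv (e \<otimes> f)) = 2 ^ Suc t" using ec fc by simp
  then have "inv (e \<otimes> f) \<in> auto_orbit e"
    using auto_transitive_max_order[OF fin exp ec comp(2)] ec fc by simp
  from auto_orbitE[OF this] obtain \<gamma> where \<gamma>: "\<gamma> \<in> auto G" "\<gamma> e = inv (e \<otimes> f)" ..
  obtain \<beta> where \<beta>: "\<beta> \<in> auto G" "\<beta> e = f"
    using auto_orbitE[OF auto_transitive_max_order[OF fin exp ec comp(2) fc fo]] ..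
  have "(\<lambda>x\<in>carrier G. x) e \<otimes> (\<beta> e \<otimes> \<gamma> e) = \<one>"
    using ec fc \<beta> \<gamma> by (simp add: r_inv flip: m_assoc)
  then have "e = \<one>" using \<open>three_free\<close> id_in_auto \<beta>(1) \<gamma>(1) ec unfolding three_free_def by (elim ballE[of _ _ "\<lambda>x\<in>carrier G. x"] ballE[of _ _ \<beta>] ballE[of _ _ \<gamma>] ballE[of _ _ e]) simp_all
  then show False using comp(2) by simp
qed

text \<open>Automorphisms of the complement extend to the group by fixing \<open>e\<close>.\<close>

lemma three_free_complement:
  assumes fin: "finite (carrier G)" and three_free and comp: "cyclic_complement e H"
  shows "comm_group.three_free (G\<lparr>carrier := H\<rparr>)"
proof -
  interpret H: subgroup H G using comp by (simp add: cyclic_complement_def)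
  interpret GH: comm_group "G\<lparr>carrier := H\<rparr>"
    by (rule subgroup_comm_group[OF H.subgroup_axioms])
  have ec: "e \<in> carrier G" using comp by (simp add: cyclic_complement_def)
  have extend: "\<exists>\<theta>\<in>auto G. \<forall>h\<in>H. \<theta> h = \<alpha> h" if \<alpha>: "\<alpha> \<in> auto (G\<lparr>carrier := H\<rparr>)" for \<alpha>
  proof -
    have \<alpha>c: "\<alpha> h \<in> H" if "h \<in> H" for h using GH.auto_closed[OF \<alpha>] that by simp
    have hom: "\<alpha> \<in> hom (G\<lparr>carrier := H\<rparr>) G" using \<alpha> \<alpha>c by (auto simp: auto_def hom_def)
    have inj: "e [^] n = \<one> \<and> h = \<one>" if h: "h \<in> H" "e [^] n \<otimes> \<alpha> h = \<one>" for n :: nat and h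
    proof -
      have "e [^] n \<otimes> \<alpha> h = e [^] (0::nat) \<otimes> \<one>" using h by simp
      then have "\<alpha> h = \<one>" using cyclic_complement_unique[OF comp \<alpha>c[OF h(1)] H.one_closed] by blast
      moreover have "\<alpha> \<one> = \<one>" using GH.auto_one[OF \<alpha>] by simp
      ultimately have "h = \<one>" using GH.auto_inj[OF \<alpha>, of h \<one>] h by simp
      with h \<open>\<alpha> h = \<one>\<close> ec show ?thesis by simp
    qed
    obtain \<theta> where \<theta>: "\<theta> \<in> auto G" "\<forall>n::nat. \<forall>h\<in>H. \<theta> (e [^] n \<otimes> h) = e [^] n \<otimes> \<alpha> h"
      using cyclic_complement_auto[OF fin comp hom ec pow_ord_eq_1[OF ec] inj] ..
    have "\<theta> h = \<alpha> h" if "h \<in> H" for h using \<theta>(2)[rule_format, OF that, of 0] that \<alpha>c by simp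
    then show ?thesis using \<theta>(1) by (intro bexI[of _ \<theta>]) simp_all
  qed
  show ?thesis unfolding GH.three_free_def
  proof (intro ballI impI)
    fix \<alpha> \<beta> \<gamma> g assume w: "\<alpha> \<in> auto (G\<lparr>carrier := H\<rparr>)" "\<beta> \<in> auto (G\<lparr>carrier := H\<rparr>)" "\<gamma> \<in> auto (G\<lparr>carrier := H\<rparr>)"
      and g: "g \<in> carrier (G\<lparr>carrier := H\<rparr>)"
      and eq: "\<alpha> g \<otimes>\<^bsub>G\<lparr>carrier := H\<rparr>\<^esub> (\<beta> g \<otimes>\<^bsub>G\<lparr>carrier := H\<rparr>\<^esub> \<gamma> g) = \<one>\<^bsub>G\<lparr>carrier := H\<rparr>\<^esub>"
    obtain \<alpha>' \<beta>' \<gamma>' where w': "\<alpha>' \<in> auto G" "\<beta>' \<in> auto G" "\<gamma>' \<in> auto G"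
      and ext: "\<forall>h\<in>H. \<alpha>' h = \<alpha> h" "\<forall>h\<in>H. \<beta>' h = \<beta> h" "\<forall>h\<in>H. \<gamma>' h = \<gamma> h"
      using extend[OF w(1)] extend[OF w(2)] extend[OF w(3)] by (elim bexE)
    have "g \<in> H" using g by simp
    then have "\<alpha>' g \<otimes> (\<beta>' g \<otimes> \<gamma>' g) = \<one>" "g \<in> carrier G" using eq ext by simp_all
    then show "g = \<one>\<^bsub>G\<lparr>carrier := H\<rparr>\<^esub>"
      using \<open>three_free\<close>[unfolded three_free_def, rule_format, OF w'] by simp
  qed
qed

end

section \<open>Direct sums of cyclic 2-groups of distinct orders\<close>

lemma carrier_cyclic_2_sum: "carrier (cyclic_2_sum r t) = (\<Pi>\<^sub>E i\<in>{1..r}. {0..<2 ^ t i})"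
  by (simp add: cyclic_2_sum_def carrier_sum_group carrier_integer_mod_group)

lemma mult_cyclic_2_sum:
  "x \<otimes>\<^bsub>cyclic_2_sum r t\<^esub> y = (\<lambda>i\<in>{1..r}. (x i + y i) mod 2 ^ t i)"
  by (simp add: cyclic_2_sum_def)

lemma one_cyclic_2_sum: "\<one>\<^bsub>cyclic_2_sum r t\<^esub> = (\<lambda>i\<in>{1..r}. 0)"
  by (simp add: cyclic_2_sum_def)

lemma comm_group_cyclic_2_sum: "comm_group (cyclic_2_sum r t)"
proof (rule group.group_comm_groupI)
  show "group (cyclic_2_sum r t)" by (simp add: cyclic_2_sum_def)
qed (simp add: mult_cyclic_2_sum add.commute)

lemma pow_cyclic_2_sum:
  assumes "i \<in> {1..r}" shows "(x [^]\<^bsub>cyclic_2_sum r t\<^esub> (n::nat)) i = (int n * x i) mod 2 ^ t i"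
  using assms
  by (induction n)
    (simp_all add: one_cyclic_2_sum mult_cyclic_2_sum nat_pow_def mod_add_left_eq mod_add_right_eq algebra_simps)

text \<open>An isomorphism \<open>\<phi>\<close> onto a sum of cyclic groups \<open>C\<^sub>i\<close> of order \<open>2 ^ t i\<close> provides coordinates
\<open>\<phi> x i\<close>, which are integers reduced modulo \<open>2 ^ t i\<close>.\<close>

locale cyclic_2_coordinates = comm_group G for G (structure) +
  fixes r :: nat and t :: "nat \<Rightarrow> nat" and \<phi>
  assumes coord_iso: "\<phi> \<in> iso G (cyclic_2_sum r t)"
begin

lemma coord_carrier: "x \<in> carrier G \<Longrightarrow> \<phi> x \<in> carrier (cyclic_2_sum r t)"
  using coord_iso by (auto simp: iso_def hom_def)

lemma coord_range: "x \<in> carrier G \<Longrightarrow> i \<in> {1..r} \<Longrightarrow> 0 \<le> \<phi> x i \<and> \<phi> x i < 2 ^ t i"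
  using coord_carrier[of x] by (auto simp: carrier_cyclic_2_sum PiE_iff)

lemma coord_mult:
  "x \<in> carrier G \<Longrightarrow> y \<in> carrier G \<Longrightarrow> i \<in> {1..r} \<Longrightarrow> \<phi> (x \<otimes> y) i = (\<phi> x i + \<phi> y i) mod 2 ^ t i"
  using coord_iso by (simp add: iso_def hom_def mult_cyclic_2_sum)

lemma coord_one: "i \<in> {1..r} \<Longrightarrow> \<phi> \<one> i = 0"
proof -
  interpret K: comm_group "cyclic_2_sum r t" by (rule comm_group_cyclic_2_sum)
  assume "i \<in> {1..r}"
  moreover have "\<phi> \<one> = \<one>\<^bsub>cyclic_2_sum r t\<^esub>"
    using coord_iso hom_one[of \<phi> G "cyclic_2_sum r t"] K.group_axioms by (simp add: iso_def)
  ultimately show ?thesis by (simp add: one_cyclic_2_sum)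
qed

lemma coord_pow:
  assumes "x \<in> carrier G" "i \<in> {1..r}" shows "\<phi> (x [^] (n::nat)) i = (int n * \<phi> x i) mod 2 ^ t i"
proof (induction n)
  case (Suc n)
  then show ?case using assms by (simp add: coord_mult mod_add_left_eq mod_add_right_eq algebra_simps)
qed (use assms in \<open>simp add: coord_one\<close>)

lemma coord_eqI:
  assumes "x \<in> carrier G" "y \<in> carrier G" "\<And>i. i \<in> {1..r} \<Longrightarrow> \<phi> x i = \<phi> y i"
  shows "x = y"
proof -
  have "\<phi> x = \<phi> y"
    using coord_carrier[OF assms(1)] coord_carrier[OF assms(2)] assms(3)
    unfolding carrier_cyclic_2_sum by (rule PiE_ext)
  moreover have "inj_on \<phi> (carrier G)" using coord_iso by (simp add: iso_def bij_betw_def)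
  ultimately show ?thesis using assms(1,2) by (simp add: inj_on_eq_iff)
qed

lemma coord_surj: "\<exists>x\<in>carrier G. \<forall>i\<in>{1..r}. \<phi> x i = a i mod 2 ^ t i"
proof -
  have "(\<lambda>i\<in>{1..r}. a i mod 2 ^ t i) \<in> carrier (cyclic_2_sum r t)"
    by (auto simp: carrier_cyclic_2_sum)
  moreover have "\<phi> ` carrier G = carrier (cyclic_2_sum r t)"
    using coord_iso by (simp add: iso_def bij_betw_def)
  ultimately have "(\<lambda>i\<in>{1..r}. a i mod 2 ^ t i) \<in> \<phi> ` carrier G" by simp
  then obtain x where x: "(\<lambda>i\<in>{1..r}. a i mod 2 ^ t i) = \<phi> x" "x \<in> carrier G" by (rule imageE)
  show ?thesis by (rule bexI[OF _ x(2)]) (simp flip: x(1))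
qed

text \<open>Tested on an element all of whose coordinates are residues of 1.\<close>

lemma coord_exponent_le:
  assumes "\<And>x. x \<in> carrier G \<Longrightarrow> x [^] (2 ^ s :: nat) = \<one>" "i \<in> {1..r}" shows "t i \<le> s"
proof (cases "t i = 0")
  case False
  obtain x where x: "x \<in> carrier G" "\<forall>i\<in>{1..r}. \<phi> x i = 1 mod 2 ^ t i" using coord_surj ..
  have "(1::int) mod 2 ^ t i = 1" using False by (intro mod_pos_pos_trivial) auto
  then have "\<phi> x i = 1" using x(2) assms(2) by simp
  moreover have "\<phi> (x [^] (2 ^ s :: nat)) i = 0" using assms x(1) by (simp add: coord_one)
  ultimately have "(2 ^ s :: int) mod 2 ^ t i = 0" using coord_pow[OF x(1) assms(2), of "2 ^ s"] by simp
  then have "int (2 ^ t i) dvd int (2 ^ s)" by (simp add: dvd_eq_mod_eq_0)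
  then have "(2 ^ t i :: nat) dvd 2 ^ s" by (simp only: of_nat_dvd_iff)
  then show ?thesis by (rule power_dvd_imp_le) simp
qed simp

end

locale strict_2_coordinates = cyclic_2_coordinates G r t \<phi> for G (structure) and r t \<phi> +
  assumes fin: "finite (carrier G)" and r_pos: "r \<ge> 1" and t_pos: "\<And>i. i \<in> {1..r} \<Longrightarrow> t i \<ge> 1"
    and t_mono: "strict_mono_on {1..r} t"
begin

lemma r_mem: "r \<in> {1..r}" using r_pos by simp

lemma t_le: "i \<in> {1..r} \<Longrightarrow> t i \<le> t r"
  using strict_mono_on_leD[OF t_mono, of i r] r_pos by simp

lemma t_less: "i \<in> {1..r} \<Longrightarrow> i \<noteq> r \<Longrightarrow> t i < t r"
  using strict_mono_onD[OF t_mono, of i r] r_pos by simp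

lemma pow_exponent: "x \<in> carrier G \<Longrightarrow> x [^] (2 ^ t r :: nat) = \<one>"
proof (rule coord_eqI)
  fix i assume x: "x \<in> carrier G" and i: "i \<in> {1..r}"
  have "(2 ^ t i :: int) dvd 2 ^ t r" using t_le[OF i] by (rule le_imp_power_dvd)
  then show "\<phi> (x [^] (2 ^ t r :: nat)) i = \<phi> \<one> i"
    using x i by (simp add: coord_pow coord_one)
qed simp_all

text \<open>Multiplication by \<open>2 ^ (t r - 1)\<close> kills all summands but the last one, and there it kills the even
residues.\<close>

lemma max_order_iff:
  assumes x: "x \<in> carrier G" shows "ord x = 2 ^ t r \<longleftrightarrow> odd (\<phi> x r)"
proof -
  obtain s where s: "t r = Suc s" using t_pos[OF r_mem] by (cases "t r") auto
  have "x [^] (2 ^ s :: nat) = \<one> \<longleftrightarrow> even (\<phi> x r)"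
  proof
    assume "x [^] (2 ^ s :: nat) = \<one>"
    then have "(2 ^ s * \<phi> x r) mod 2 ^ Suc s = 0"
      using coord_pow[OF x r_mem, of "2 ^ s"] coord_one[OF r_mem] s by simp
    then have "(2 ^ s * 2 :: int) dvd 2 ^ s * \<phi> x r" by (simp add: dvd_eq_mod_eq_0 mult.commute)
    then show "even (\<phi> x r)" by (subst (asm) dvd_mult_cancel_left) simp
  next
    assume ev: "even (\<phi> x r)"
    show "x [^] (2 ^ s :: nat) = \<one>"
    proof (rule coord_eqI)
      fix i assume i: "i \<in> {1..r}"
      have "(2 ^ t i :: int) dvd 2 ^ s * \<phi> x i"
      proof (cases "i = r")
        case True
        have "(2 ^ s * 2 :: int) dvd 2 ^ s * \<phi> x r" using ev by (intro mult_dvd_mono) auto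
        then show ?thesis using True s by (simp add: mult.commute)
      next
        case False
        then have "t i \<le> s" using t_less[OF i] s by simp
        then show ?thesis by (intro dvd_mult2 le_imp_power_dvd)
      qed
      then show "\<phi> (x [^] (2 ^ s :: nat)) i = \<phi> \<one> i" using coord_pow[OF x i] coord_one[OF i] by simp
    qed (use x in simp_all)
  qed
  moreover have "ord x = 2 ^ Suc s \<longleftrightarrow> x [^] (2 ^ s :: nat) \<noteq> \<one>"
    using ord_eq_power_2[OF x, of s] pow_exponent[OF x] s pow_eq_id[OF x, of "2 ^ s"]
    by (auto dest: power_dvd_imp_le)
  ultimately show ?thesis using s by simp
qed

lemma parity_mult:
  "x \<in> carrier G \<Longrightarrow> y \<in> carrier G \<Longrightarrow> odd (\<phi> (x \<otimes> y) r) \<longleftrightarrow> odd (\<phi> x r) \<noteq> odd (\<phi> y r)"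
proof -
  assume "x \<in> carrier G" "y \<in> carrier G"
  then have "\<phi> (x \<otimes> y) r = (\<phi> x r + \<phi> y r) mod 2 ^ t r" using r_mem by (rule coord_mult)
  moreover have "(2::int) dvd 2 ^ t r" using t_pos[OF r_mem] by (simp add: dvd_power)
  ultimately show ?thesis by (simp add: dvd_mod_iff)
qed

text \<open>The subgroup \<open>2 ^ k G\<close>; its elements are those of height at least \<open>k\<close> in the sense of abelian group theory.\<close>

definition height_ge :: "nat \<Rightarrow> 'a set" where
  "height_ge k = {y [^] (2 ^ k :: nat) | y. y \<in> carrier G}"

lemma height_ge_iff: "x \<in> height_ge k \<longleftrightarrow> (\<exists>y\<in>carrier G. x = y [^] (2 ^ k :: nat))"
  by (auto simp: height_ge_def)

lemma socle_coord:
  assumes "x \<in> carrier G" "x \<otimes> x = \<one>" "i \<in> {1..r}" "\<phi> x i \<noteq> 0" shows "2 * \<phi> x i = 2 ^ t i"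
proof -
  have "(2 * \<phi> x i) mod 2 ^ t i = 0"
    using coord_mult[OF assms(1,1,3)] assms(2) coord_one[OF assms(3)] by simp
  then obtain q where q: "2 * \<phi> x i = 2 ^ t i * q" by (auto simp: mod_eq_0_iff_dvd)
  have "0 < 2 ^ t i * q" "2 ^ t i * q < 2 ^ t i * 2"
    unfolding q[symmetric] using coord_range[OF assms(1,3)] assms(4) by linarith+
  then have "0 < q" "q < 2" by (simp add: zero_less_mult_iff, simp only: mult_less_cancel_left_pos zero_less_power zero_less_numeral)
  then have "q = 1" by simp
  then show ?thesis using q by simp
qed

text \<open>The coordinates of an element of order at most 2 are \<open>0\<close> or half the modulus, and half of \<open>2 ^ t i\<close> is
divisible by \<open>2 ^ k\<close> if and only if \<open>k < t i\<close>.\<close>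

lemma socle_height:
  assumes x: "x \<in> carrier G" "x \<otimes> x = \<one>"
  shows "x \<in> height_ge k \<longleftrightarrow> (\<forall>i\<in>{1..r}. \<phi> x i \<noteq> 0 \<longrightarrow> k < t i)"
proof
  assume "x \<in> height_ge k"
  then obtain y where y: "y \<in> carrier G" "x = y [^] (2 ^ k :: nat)" by (auto simp: height_ge_iff)
  show "\<forall>i\<in>{1..r}. \<phi> x i \<noteq> 0 \<longrightarrow> k < t i"
  proof (intro ballI impI, rule ccontr)
    fix i assume i: "i \<in> {1..r}" "\<phi> x i \<noteq> 0" "\<not> k < t i"
    then have "(2 ^ t i :: int) dvd 2 ^ k" by (intro le_imp_power_dvd) simp
    then have "\<phi> x i = 0" unfolding y(2) using coord_pow[OF y(1) i(1), of "2 ^ k"] by simp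
    with i(2) show False ..
  qed
next
  assume k: "\<forall>i\<in>{1..r}. \<phi> x i \<noteq> 0 \<longrightarrow> k < t i"
  define a where "a i = (if \<phi> x i = 0 then 0 else 2 ^ (t i - Suc k) :: int)" for i
  obtain y where y: "y \<in> carrier G" "\<forall>i\<in>{1..r}. \<phi> y i = a i mod 2 ^ t i" using coord_surj ..
  have "x = y [^] (2 ^ k :: nat)"
  proof (rule coord_eqI)
    fix i assume i: "i \<in> {1..r}"
    have "\<phi> (y [^] (2 ^ k :: nat)) i = (2 ^ k * a i) mod 2 ^ t i"
      using coord_pow[OF y(1) i, of "2 ^ k"] y(2) i by (simp add: mod_mult_right_eq)
    also have "2 ^ k * a i = \<phi> x i"
    proof (cases "\<phi> x i = 0")
      case False
      then have "k < t i" using k i by simp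
      then have "t i = Suc (k + (t i - Suc k))" by simp
      then have "(2::int) ^ t i = 2 * (2 ^ k * 2 ^ (t i - Suc k))" by (metis power_Suc power_add)
      then show ?thesis using socle_coord[OF x i False] False by (simp add: a_def)
    qed (simp add: a_def)
    also have "\<phi> x i mod 2 ^ t i = \<phi> x i" using coord_range[OF x(1) i] by simp
    finally show "\<phi> x i = \<phi> (y [^] (2 ^ k :: nat)) i" by simp
  qed (use x y in simp_all)
  with y(1) show "x \<in> height_ge k" by (auto simp: height_ge_iff)
qed

text \<open>The Ulm invariants of the group are at most 1. Only a summand of order \<open>2 ^ (k + 1)\<close> can keep an element
of order 2 and height at least \<open>k\<close> from having greater height. As there is at most one such summand, both \<open>x\<close> and \<open>y\<close> have
the same nonzero coordinate in it, and these coordinates cancel in the sum.\<close>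

lemma socle_height_step:
  assumes x: "x \<in> carrier G" "x \<otimes> x = \<one>" "x \<in> height_ge k" "x \<notin> height_ge (Suc k)"
    and y: "y \<in> carrier G" "y \<otimes> y = \<one>" "y \<in> height_ge k" "y \<notin> height_ge (Suc k)"
  shows "x \<otimes> y \<in> height_ge (Suc k)"
proof -
  have witness: "\<phi> z i \<noteq> 0"
    if z: "z \<in> carrier G" "z \<otimes> z = \<one>" "z \<in> height_ge k" "z \<notin> height_ge (Suc k)"
      and i: "i \<in> {1..r}" "t i = Suc k" for z i
  proof -
    obtain j where j: "j \<in> {1..r}" "\<phi> z j \<noteq> 0" "\<not> Suc k < t j"
      using z(4) unfolding socle_height[OF z(1,2)] by blast
    then have "t j = t i" using z(3) i unfolding socle_height[OF z(1,2)] by fastforce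
    then have "j = i" using strict_mono_on_imp_inj_on[OF t_mono] j(1) i(1) by (simp add: inj_on_eq_iff)
    then show ?thesis using j(2) by simp
  qed
  have c: "x \<otimes> y \<in> carrier G" "(x \<otimes> y) \<otimes> (x \<otimes> y) = \<one>"
  proof -
    have "(x \<otimes> y) \<otimes> (x \<otimes> y) = (x \<otimes> x) \<otimes> (y \<otimes> y)" using x(1) y(1) by (simp add: m_ac)
    then show "(x \<otimes> y) \<otimes> (x \<otimes> y) = \<one>" using x(2) y(2) by simp
  qed (use x y in simp)
  show ?thesis unfolding socle_height[OF c]
  proof (intro ballI impI)
    fix i assume i: "i \<in> {1..r}" and ne: "\<phi> (x \<otimes> y) i \<noteq> 0"
    then have "\<phi> x i \<noteq> 0 \<or> \<phi> y i \<noteq> 0" using coord_mult[OF x(1) y(1) i] by auto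
    then have "k < t i" using x(3) y(3) i unfolding socle_height[OF x(1,2)] socle_height[OF y(1,2)] by auto
    moreover have "t i \<noteq> Suc k"
    proof
      assume t: "t i = Suc k"
      have "2 * \<phi> x i = 2 ^ t i" "2 * \<phi> y i = 2 ^ t i"
        using socle_coord[OF x(1,2) i witness[OF x i t]] socle_coord[OF y(1,2) i witness[OF y i t]] .
      then have "\<phi> x i + \<phi> y i = 2 ^ t i" by simp
      then show False using ne coord_mult[OF x(1) y(1) i] by simp
    qed
    ultimately show "Suc k < t i" by simp
  qed
qed

lemma height_ge_auto:
  assumes "\<alpha> \<in> auto G" "x \<in> carrier G" shows "\<alpha> x \<in> height_ge k \<longleftrightarrow> x \<in> height_ge k"
proof -
  have imp: "\<beta> y \<in> height_ge k" if \<beta>: "\<beta> \<in> auto G" and y: "y \<in> height_ge k" for \<beta> y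
  proof -
    obtain z where z: "z \<in> carrier G" "y = z [^] (2 ^ k :: nat)" using y unfolding height_ge_iff ..
    then have "\<beta> y = \<beta> z [^] (2 ^ k :: nat)" using auto_pow[OF \<beta>] by simp
    then show ?thesis unfolding height_ge_iff using auto_closed[OF \<beta> z(1)] by blast
  qed
  obtain \<beta> where \<beta>: "\<beta> \<in> auto G" "\<forall>x\<in>carrier G. \<beta> (\<alpha> x) = x" using auto_inverse[OF assms(1)] ..
  show ?thesis
  proof
    assume "\<alpha> x \<in> height_ge k"
    from imp[OF \<beta>(1) this] show "x \<in> height_ge k" using \<beta>(2) assms(2) by simp
  qed (rule imp[OF assms(1)])
qed

text \<open>Let \<open>x\<close> be a nonzero element of the kernel of \<open>\<alpha> + \<beta> + \<gamma>\<close>. Some multiple \<open>z\<close> of \<open>x\<close> has order 2. Let \<open>j\<close> be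
its height. By \<open>height_ge_auto\<close> the images \<open>\<alpha> z\<close>, \<open>\<beta> z\<close> and \<open>\<gamma> z\<close> have height \<open>j\<close> as well, whereas \<open>\<alpha> z + \<beta> z\<close>
has larger height by \<open>socle_height_step\<close>. This contradicts \<open>\<gamma> z = -(\<alpha> z + \<beta> z)\<close>.\<close>

lemma sum_of_three_autos:
  assumes a: "\<alpha> \<in> auto G" "\<beta> \<in> auto G" "\<gamma> \<in> auto G"
  shows "\<exists>\<delta>\<in>auto G. \<forall>x\<in>carrier G. \<alpha> x \<otimes> (\<beta> x \<otimes> \<gamma> x) = \<delta> x"
proof -
  define \<theta> where "\<theta> x = \<alpha> x \<otimes> (\<beta> x \<otimes> \<gamma> x)" for x
  note cl = auto_closed[OF a(1)] auto_closed[OF a(2)] auto_closed[OF a(3)]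
  have hom: "\<theta> \<in> hom G G"
  proof (rule homI)
    fix x y assume xy: "x \<in> carrier G" "y \<in> carrier G"
    show "\<theta> x \<in> carrier G" using cl[OF xy(1)] by (simp add: \<theta>_def)
    show "\<theta> (x \<otimes> y) = \<theta> x \<otimes> \<theta> y"
      using cl[OF xy(1)] cl[OF xy(2)] auto_mult[OF a(1) xy] auto_mult[OF a(2) xy] auto_mult[OF a(3) xy]
      by (simp add: \<theta>_def m_ac)
  qed
  interpret \<theta>: group_hom G G \<theta> using hom by unfold_locales
  have "x = \<one>" if x: "x \<in> carrier G" "\<theta> x = \<one>" for x
  proof (rule ccontr)
    assume "x \<noteq> \<one>"
    define n where "n = (LEAST n. x [^] (2 ^ n :: nat) = \<one>)"
    have n: "x [^] (2 ^ n :: nat) = \<one>" unfolding n_def by (rule LeastI[of _ "t r"]) (rule pow_exponent[OF x(1)])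
    have "n \<noteq> 0" using n \<open>x \<noteq> \<one>\<close> x by (intro notI) simp
    then obtain m where m: "n = Suc m" by (cases n) auto
    define z where "z = x [^] (2 ^ m :: nat)"
    have "z \<noteq> \<one>" using not_less_Least[of m "\<lambda>n. x [^] (2 ^ n :: nat) = \<one>"] m by (simp add: z_def n_def)
    have z: "z \<in> carrier G" "z \<otimes> z = \<one>"
      using x n by (simp_all add: z_def m nat_pow_mult mult_2)
    have "\<theta> z = \<one>" using x by (simp add: z_def \<theta>.hom_nat_pow)
    define k where "k = (LEAST k. z \<notin> height_ge k)"
    have "z \<notin> height_ge (t r)" using \<open>z \<noteq> \<one>\<close> pow_exponent by (auto simp: height_ge_iff)
    then have k: "z \<notin> height_ge k" unfolding k_def by (rule LeastI)
    have "z \<in> height_ge 0" using z(1) by (auto simp: height_ge_iff)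
    then have "k \<noteq> 0" using k by (intro notI) simp
    then obtain j where j: "k = Suc j" by (cases k) auto
    then have "z \<in> height_ge j" using not_less_Least[of j "\<lambda>k. z \<notin> height_ge k"] by (simp add: k_def)
    then have image: "\<delta> z \<in> carrier G \<and> \<delta> z \<otimes> \<delta> z = \<one> \<and> \<delta> z \<in> height_ge j \<and> \<delta> z \<notin> height_ge (Suc j)"
      if "\<delta> \<in> auto G" for \<delta>
      using that k z height_ge_auto[OF that z(1)] auto_closed[OF that z(1)]
        auto_mult[OF that z(1) z(1)] auto_one[OF that] unfolding j by simp
    note i = image[OF a(1)] image[OF a(2)] image[OF a(3)]
    have "\<alpha> z \<otimes> \<beta> z \<in> height_ge (Suc j)" using i by (intro socle_height_step[of _ j]) simp_all
    then obtain y where y: "y \<in> carrier G" "\<alpha> z \<otimes> \<beta> z = y [^] (2 ^ Suc j :: nat)"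
      unfolding height_ge_iff ..
    have "y [^] (2 ^ Suc j :: nat) \<otimes> \<gamma> z = \<one>"
      using \<open>\<theta> z = \<one>\<close> i unfolding y(2)[symmetric] by (simp add: \<theta>_def m_assoc)
    then have "\<gamma> z = inv (y [^] (2 ^ Suc j :: nat))"
      using i y(1) inv_equality[of "\<gamma> z" "y [^] (2 ^ Suc j :: nat)"] m_comm by simp
    also have "\<dots> = inv y [^] (2 ^ Suc j :: nat)" using y(1) by (simp add: nat_pow_inv)
    finally have "\<gamma> z \<in> height_ge (Suc j)" unfolding height_ge_iff using y(1) inv_closed by blast
    with i show False by simp
  qed
  then have "restrict \<theta> (carrier G) \<in> auto G" by (rule auto_of_hom[OF fin hom])
  then show ?thesis by (intro bexI[of _ "restrict \<theta> (carrier G)"]) (simp_all add: \<theta>_def)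
qed

end

sublocale strict_2_coordinates \<subseteq> signed_weights G "auto G"
  by unfold_locales (simp_all add: plus_minus_id_auto comm_group_axioms)

context strict_2_coordinates
begin

lemma seminormal_auto: "seq_seminormal G B"
proof (rule seminormalI)
  fix g \<alpha> \<beta> \<gamma> assume g: "g \<in> carrier G" and a: "\<alpha> \<in> auto G" "\<beta> \<in> auto G" "\<gamma> \<in> auto G"
  obtain \<delta> where "\<delta> \<in> auto G" "\<forall>x\<in>carrier G. \<alpha> x \<otimes> (\<beta> x \<otimes> \<gamma> x) = \<delta> x"
    using sum_of_three_autos[OF a] ..
  then show "\<exists>\<delta>\<in>auto G. \<alpha> g \<otimes> (\<beta> g \<otimes> \<gamma> g) = \<delta> g" using g by (intro bexI[of _ \<delta>]) simp_all
qed

lemma ord_auto: "\<alpha> \<in> auto G \<Longrightarrow> g \<in> carrier G \<Longrightarrow> ord (\<alpha> g) = ord g"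
proof -
  assume a: "\<alpha> \<in> auto G" "g \<in> carrier G"
  have "\<alpha> g [^] n = \<one> \<longleftrightarrow> g [^] n = \<one>" for n :: nat
    using a auto_inj[OF a(1), of "g [^] n" \<one>] auto_pow[OF a, of n] auto_one[OF a(1)] by auto
  then show ?thesis using a auto_closed[OF a] by (simp add: ord_unique pow_eq_id)
qed

abbreviation max_terms where "max_terms \<equiv> num_of_order G (2 ^ t r)"

lemma max_terms_add_mset:
  "g \<in> carrier G \<Longrightarrow> odd (max_terms (add_mset g S)) \<longleftrightarrow> odd (\<phi> g r) \<noteq> odd (max_terms S)"
  by (simp add: num_of_order_def max_order_iff)

lemma max_terms_union: "max_terms (S + T) = max_terms S + max_terms T"
  by (simp add: num_of_order_def)

text \<open>The last coordinate is odd exactly for the elements of maximal order, and automorphisms preserve orders.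
So every attainable sum has as its last coordinate modulo 2 the number of terms of maximal order.\<close>

lemma weighted_sum_parity:
  "weighted_sum G (auto G) S x \<Longrightarrow> odd (max_terms S) \<longleftrightarrow> odd (\<phi> x r)"
proof (induction rule: weighted_sum.induct)
  case empty
  then show ?case using coord_one[OF r_mem] by (simp add: num_of_order_def)
next
  case (add S x \<gamma> g)
  have "odd (\<phi> (\<gamma> g) r) \<longleftrightarrow> odd (\<phi> g r)"
    using max_order_iff auto_closed[OF add.hyps(2,3)] ord_auto[OF add.hyps(2,3)] add.hyps(3) by metis
  then show ?case
    using add.IH max_terms_add_mset[OF add.hyps(3)] weighted_sum_closed[OF add.hyps(1)]
      parity_mult[OF auto_closed[OF add.hyps(2,3)]] by metis
qed

text \<open>An automorphism takes \<open>g\<close> to \<open>h\<close>, and \<open>h - h = 0\<close>.\<close>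

lemma two_max_terms_zero_sum:
  assumes "g \<in> carrier G" "ord g = 2 ^ t r" "h \<in> carrier G" "ord h = 2 ^ t r"
  shows "{#g, h#} \<in> B"
proof -
  have "h \<in> auto_orbit g" by (rule auto_transitive_max_order[OF fin]) (use pow_exponent assms in simp_all)
  from auto_orbitE[OF this] obtain \<gamma> where \<gamma>: "\<gamma> \<in> auto G" "\<gamma> g = h" ..
  then have "weighted_sum G (auto G) {#g#} h" using assms(1) unfolding weighted_sum_single by blast
  then have "weighted_sum G (auto G) ({#g#} + {#h#}) (h \<otimes> inv h)"
    unfolding weighted_sum_union using weighted_sum_pm(2)[OF assms(3)] by blast
  then show ?thesis using assms(3) by (simp add: weighted_zero_sum_iff add_mset_commute)
qed

text \<open>Up to factors in the quotient group of \<open>B\<close>, any two elements of maximal order cancel, and an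
element \<open>g\<close> of smaller order is trivial: \<open>g\<close>, \<open>e\<close> and \<open>g + e\<close> form a zero-sum sequence
because \<open>g + e - (g + e) = 0\<close>, and \<open>e\<close>, \<open>g + e\<close> both have maximal order. An
additional factor \<open>e\<close> repairs odd parity and keeps the induction on \<open>S\<close> going.\<close>

lemma even_max_terms_in_group:
  assumes S: "S \<in> free_abelian_monoid G"
    and e: "e \<in> carrier G" "ord e = 2 ^ t r"
  shows "\<exists>T\<in>B. (if even (max_terms S) then S else add_mset e S) + T \<in> B"
  using S
proof (induction S)
  case empty
  then show ?case using zero_sum_empty by (intro bexI[of _ "{#}"]) (simp_all add: num_of_order_def)
next
  case (add g S)
  then have g: "g \<in> carrier G" and S: "S \<in> free_abelian_monoid G" by (auto simp: free_abelian_monoid_def)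
  let ?p = "\<lambda>S. if even (max_terms S) then S else add_mset e S"
  obtain T where T: "T \<in> B" "?p S + T \<in> B" using add.IH[OF S] ..
  have join: "\<exists>T\<in>B. ?p (add_mset g S) + T \<in> B"
    if "U \<in> B" "V \<in> B" "?p (add_mset g S) + V = ?p S + U" for U V
  proof -
    have "?p (add_mset g S) + (V + T) = ?p S + U + T" by (simp only: that(3) flip: add.assoc)
    also have "\<dots> = (?p S + T) + U" by (simp only: add.assoc add.commute[of U T])
    also have "\<dots> \<in> B" by (rule zero_sum_union[OF T(2) that(1)])
    finally show ?thesis by (rule bexI[OF _ zero_sum_union[OF that(2) T(1)]])
  qed
  have ee: "{#e, e#} \<in> B" by (rule two_max_terms_zero_sum[OF e e])
  show ?case
  proof (cases "odd (\<phi> g r)")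
    case True
    then have ge: "{#g, e#} \<in> B" using two_max_terms_zero_sum g e max_order_iff by simp
    show ?thesis
    proof (cases "even (max_terms S)")
      case ev: True
      show ?thesis by (rule join[OF ge zero_sum_empty]) (use True ev max_terms_add_mset[OF g, of S] in simp)
    next
      case odd: False
      show ?thesis by (rule join[OF ge ee]) (use True odd max_terms_add_mset[OF g, of S] in simp)
    qed
  next
    case False
    have ge: "g \<otimes> e \<in> carrier G" "ord (g \<otimes> e) = 2 ^ t r"
      using parity_mult[OF g e(1)] False e max_order_iff[of e] max_order_iff[of "g \<otimes> e"] g by simp_all
    have "weighted_sum G (auto G) ({#g#} + ({#e#} + {#g \<otimes> e#})) (g \<otimes> (e \<otimes> inv (g \<otimes> e)))"
      unfolding weighted_sum_union
      using weighted_sum_pm(1)[OF g] weighted_sum_pm(1)[OF e(1)] weighted_sum_pm(2)[OF ge(1)] by blast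
    moreover have "g \<otimes> (e \<otimes> inv (g \<otimes> e)) = \<one>" using g e(1) r_inv[OF ge(1)] m_assoc[OF g e(1) inv_closed[OF ge(1)]] by simp
    ultimately have "{#g, e, g \<otimes> e#} \<in> B" by (simp add: weighted_zero_sum_iff add_mset_commute)
    then show ?thesis
      by (rule join[OF _ two_max_terms_zero_sum[OF e ge]])
        (use False max_terms_add_mset[OF g, of S] in \<open>simp add: add_mset_commute\<close>)
  qed
qed

lemma closure_auto:
  "seq_closure G B = frag_of_mset ` {S \<in> free_abelian_monoid G. even (max_terms S)}"
proof -
  have B: "even (max_terms S)" if "S \<in> B" for S
    using weighted_sum_parity[of S \<one>] that coord_one[OF r_mem] by (simp add: weighted_zero_sum_iff)
  obtain e where e: "e \<in> carrier G" "\<forall>i\<in>{1..r}. \<phi> e i = 1 mod 2 ^ t i" using coord_surj ..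
  have "(2::int) dvd 2 ^ t r" using t_pos[OF r_mem] by (simp add: dvd_power)
  then have "odd (\<phi> e r)" using e(2) r_mem by (simp add: dvd_mod_iff)
  then have e': "ord e = 2 ^ t r" using max_order_iff[OF e(1)] by simp
  have "(\<exists>T\<in>B. S + T \<in> B) \<longleftrightarrow> even (max_terms S)" if S: "S \<in> free_abelian_monoid G" for S
  proof
    assume "\<exists>T\<in>B. S + T \<in> B"
    then obtain T where T: "T \<in> B" "S + T \<in> B" by blast
    show "even (max_terms S)" using B[OF T(1)] B[OF T(2)] by (simp add: max_terms_union)
  next
    assume "even (max_terms S)"
    then show "\<exists>T\<in>B. S + T \<in> B" using even_max_terms_in_group[OF S e(1) e'] by simp
  qed
  then show ?thesis unfolding closure_eq by blast
qed

end

section \<open>Groups in which three automorphic images never cancel\<close>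

lemma card_cyclic_2_sum_0: "card (carrier (cyclic_2_sum 0 t)) = 1"
  by (simp add: carrier_cyclic_2_sum)

text \<open>The coordinates on \<open>H\<close> together with the multiple of \<open>e\<close> modulo its order are coordinates on the whole group.\<close>

lemma (in comm_group) split_off_max_cyclic:
  assumes fin: "finite (carrier G)" and comp: "cyclic_complement e H" and e: "ord e = 2 ^ s" "s \<ge> 1"
    and \<psi>: "\<psi> \<in> iso (G\<lparr>carrier := H\<rparr>) (cyclic_2_sum r t)"
  shows "G \<cong> cyclic_2_sum (Suc r) (t(Suc r := s))"
proof -
  define t' where "t' = t(Suc r := s)"
  let ?K = "cyclic_2_sum (Suc r) t'"
  interpret K: comm_group ?K by (rule comm_group_cyclic_2_sum)
  interpret H: subgroup H G using comp by (simp add: cyclic_complement_def)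
  interpret GH: comm_group "G\<lparr>carrier := H\<rparr>"
    by (rule subgroup_comm_group[OF H.subgroup_axioms])
  interpret C: cyclic_2_coordinates "G\<lparr>carrier := H\<rparr>" r t \<psi> using \<psi> by unfold_locales
  have ec: "e \<in> carrier G" using comp by (simp add: cyclic_complement_def)
  have t': "t' (Suc r) = s" "\<And>i. i \<le> r \<Longrightarrow> t' i = t i" by (simp_all add: t'_def)
  (* The coordinate vector of \<open>e\<close> is the last unit vector; those of elements of \<open>H\<close> are extended by zero. *)
  define f :: "nat \<Rightarrow> int" where "f = (\<lambda>i\<in>{1..Suc r}. if i \<le> r then 0 else 1)"
  define \<eta> where "\<eta> h = (\<lambda>i\<in>{1..Suc r}. if i \<le> r then \<psi> h i else 0)" for h
  have range: "0 \<le> \<psi> h i \<and> \<psi> h i < 2 ^ t i" if "h \<in> H" "1 \<le> i" "i \<le> r" for h i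
    using C.coord_range[of h i] that by simp
  have one_less: "(1::int) < 2 ^ s" using e(2) by (simp add: one_less_power)
  have f: "f \<in> carrier ?K" using one_less t' by (auto simp: carrier_cyclic_2_sum f_def le_Suc_eq)
  have \<eta>: "\<eta> h \<in> carrier ?K" if "h \<in> H" for h
    using range[OF that] t' by (auto simp: carrier_cyclic_2_sum \<eta>_def le_Suc_eq)
  have \<eta>_hom: "\<eta> \<in> hom (G\<lparr>carrier := H\<rparr>) ?K"
  proof (rule homI)
    fix g h assume gh: "g \<in> carrier (G\<lparr>carrier := H\<rparr>)" "h \<in> carrier (G\<lparr>carrier := H\<rparr>)"
    show "\<eta> g \<in> carrier ?K" using gh \<eta> by simp
    show "\<eta> (g \<otimes>\<^bsub>G\<lparr>carrier := H\<rparr>\<^esub> h) = \<eta> g \<otimes>\<^bsub>?K\<^esub> \<eta> h"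
      using C.coord_mult[OF gh] t' by (auto simp: mult_cyclic_2_sum \<eta>_def fun_eq_iff)
  qed
  have f_ord: "f [^]\<^bsub>?K\<^esub> ord e = \<one>\<^bsub>?K\<^esub>"
  proof (rule PiE_ext)
    show "f [^]\<^bsub>?K\<^esub> ord e \<in> (\<Pi>\<^sub>E i\<in>{1..Suc r}. {0..<2 ^ t' i})" "\<one>\<^bsub>?K\<^esub> \<in> (\<Pi>\<^sub>E i\<in>{1..Suc r}. {0..<2 ^ t' i})"
      using f unfolding carrier_cyclic_2_sum[symmetric] by simp_all
    fix i assume "i \<in> {1..Suc r}"
    then show "(f [^]\<^bsub>?K\<^esub> ord e) i = \<one>\<^bsub>?K\<^esub> i"
      using t' e by (auto simp: pow_cyclic_2_sum one_cyclic_2_sum f_def le_Suc_eq)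
  qed
  obtain \<theta> where \<theta>: "\<theta> \<in> hom G ?K"
    "\<forall>n::nat. \<forall>h\<in>H. \<theta> (e [^] n \<otimes> h) = f [^]\<^bsub>?K\<^esub> n \<otimes>\<^bsub>?K\<^esub> \<eta> h"
    using cyclic_complement_hom[OF comp comm_group_cyclic_2_sum \<eta>_hom f f_ord] ..
  have \<theta>_low: "\<theta> (e [^] n \<otimes> h) i = \<psi> h i" if "h \<in> H" "1 \<le> i" "i \<le> r" for n :: nat and h i
    using \<theta>(2) that t' range[OF that] by (simp add: mult_cyclic_2_sum pow_cyclic_2_sum f_def \<eta>_def)
  have \<theta>_top: "\<theta> (e [^] n \<otimes> h) (Suc r) = int n mod 2 ^ s" if "h \<in> H" for n :: nat and h
    using \<theta>(2) that t' by (simp add: mult_cyclic_2_sum pow_cyclic_2_sum f_def \<eta>_def)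
  have decompose: "\<exists>n::nat. \<exists>h\<in>H. x = e [^] n \<otimes> h" if "x \<in> carrier G" for x
    using comp that by (simp add: cyclic_complement_def)
  interpret \<theta>: group_hom G ?K \<theta> using \<theta>(1) by unfold_locales
  have "inj_on \<theta> (carrier G)"
  unfolding \<theta>.inj_on_one_iff
  proof (intro allI ballI impI)
    fix x assume x: "x \<in> carrier G" "\<theta> x = \<one>\<^bsub>?K\<^esub>"
    obtain n :: nat and h where h: "h \<in> H" "x = e [^] n \<otimes> h" using decompose[OF x(1)] by blast
    have "h = \<one>\<^bsub>G\<lparr>carrier := H\<rparr>\<^esub>"
    proof (rule C.coord_eqI)
      fix i assume i: "i \<in> {1..r}"
      have "\<psi> h i = \<theta> x i" unfolding h(2) using \<theta>_low[OF h(1)] i by simp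
      also have "\<dots> = 0" unfolding x(2) using i by (simp add: one_cyclic_2_sum)
      finally show "\<psi> h i = \<psi> \<one>\<^bsub>G\<lparr>carrier := H\<rparr>\<^esub> i" using C.coord_one[OF i] by simp
    qed (use h in simp_all)
    moreover have "int n mod 2 ^ s = 0"
      using \<theta>_top[OF h(1), of n] unfolding h(2)[symmetric] x(2) by (simp add: one_cyclic_2_sum)
    then have "int (2 ^ s) dvd int n" by (simp add: dvd_eq_mod_eq_0)
    then have "2 ^ s dvd n" by (simp only: of_nat_dvd_iff)
    then have "e [^] n = \<one>" using pow_eq_id[OF ec] e by simp
    ultimately show "x = \<one>" using h(2) by simp
  qed
  moreover have "carrier ?K \<subseteq> \<theta> ` carrier G"
  proof
    fix x assume x: "x \<in> carrier ?K"
    obtain h where h: "h \<in> carrier (G\<lparr>carrier := H\<rparr>)" "\<forall>i\<in>{1..r}. \<psi> h i = x i mod 2 ^ t i"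
      using C.coord_surj ..
    define n where "n = nat (x (Suc r))"
    have hc: "e [^] n \<otimes> h \<in> carrier G" using h ec by simp
    have xr: "0 \<le> x i \<and> x i < 2 ^ t' i" if "i \<in> {1..Suc r}" for i
      using x that by (auto simp: carrier_cyclic_2_sum PiE_iff)
    have "\<theta> (e [^] n \<otimes> h) = x"
    proof (rule PiE_ext)
      show "\<theta> (e [^] n \<otimes> h) \<in> (\<Pi>\<^sub>E i\<in>{1..Suc r}. {0..<2 ^ t' i})"
        "x \<in> (\<Pi>\<^sub>E i\<in>{1..Suc r}. {0..<2 ^ t' i})"
        using \<theta>.hom_closed[OF hc] x unfolding carrier_cyclic_2_sum .
      fix i assume i: "i \<in> {1..Suc r}"
      show "\<theta> (e [^] n \<otimes> h) i = x i"
      proof (cases "i \<le> r")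
        case True
        then show ?thesis using \<theta>_low[of h i] h i xr[OF i] t' by simp
      next
        case False
        then have "i = Suc r" using i by simp
        then have "int n = x (Suc r)" "x (Suc r) mod 2 ^ s = x (Suc r)"
          using xr[of "Suc r"] t'(1) by (simp_all add: n_def)
        then show ?thesis using \<theta>_top[of h n] h \<open>i = Suc r\<close> by simp
      qed
    qed
    then show "x \<in> \<theta> ` carrier G" using hc by (metis image_eqI)
  qed
  moreover have "\<theta> ` carrier G \<subseteq> carrier ?K" by auto
  ultimately have "\<theta> \<in> iso G ?K" using \<theta>(1) by (simp add: iso_def bij_betw_def subset_antisym)
  then show ?thesis unfolding is_iso_def t'_def by blast
qed

text \<open>Induction on the size of the group: an element of maximal order splits off, and the exponent of its
complement is smaller by \<open>three_free_complement_exponent\<close>, so that the exponents strictly increase.\<close>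

lemma three_free_imp_cyclic_2_sum:
  fixes G :: "('a, 'b) monoid_scheme"
  assumes "comm_group G" "finite (carrier G)" "comm_group.three_free G"
    and "\<And>x. x \<in> carrier G \<Longrightarrow> x [^]\<^bsub>G\<^esub> (2 ^ T :: nat) = \<one>\<^bsub>G\<^esub>"
  shows "\<exists>r t. (\<forall>i\<in>{1..r}. t i \<ge> 1) \<and> strict_mono_on {1..r} t \<and> G \<cong> cyclic_2_sum r t"
  using assms
proof (induction "card (carrier G)" arbitrary: G rule: less_induct)
  case less
  interpret comm_group G by (rule less.prems(1))
  define s where "s = (LEAST s. \<forall>x\<in>carrier G. x [^]\<^bsub>G\<^esub> (2 ^ s :: nat) = \<one>\<^bsub>G\<^esub>)"
  have s: "\<forall>x\<in>carrier G. x [^]\<^bsub>G\<^esub> (2 ^ s :: nat) = \<one>\<^bsub>G\<^esub>"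
    unfolding s_def by (rule LeastI[of _ T]) (simp add: less.prems(4))
  show ?case
  proof (cases s)
    case 0
    then have triv: "carrier G = {\<one>\<^bsub>G\<^esub>}" using s by auto
    have "(\<lambda>_. \<lambda>_. undefined) \<in> iso G (cyclic_2_sum 0 (\<lambda>_. 1))"
      by (auto simp: iso_def hom_def triv carrier_cyclic_2_sum mult_cyclic_2_sum bij_betw_def)
    then have "G \<cong> cyclic_2_sum 0 (\<lambda>_. 1)" unfolding is_iso_def by blast
    then show ?thesis by (intro exI[of _ 0] exI[of _ "\<lambda>_. 1"]) (simp add: strict_mono_on_def)
  next
    case (Suc m)
    have "\<not> (\<forall>x\<in>carrier G. x [^]\<^bsub>G\<^esub> (2 ^ m :: nat) = \<one>\<^bsub>G\<^esub>)"
      using not_less_Least[of m "\<lambda>s. \<forall>x\<in>carrier G. x [^]\<^bsub>G\<^esub> (2 ^ s :: nat) = \<one>\<^bsub>G\<^esub>"] Suc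
      unfolding s_def by simp
    then obtain e where e: "e \<in> carrier G" "e [^]\<^bsub>G\<^esub> (2 ^ m :: nat) \<noteq> \<one>\<^bsub>G\<^esub>" by blast
    have exp: "x [^]\<^bsub>G\<^esub> (2 ^ Suc m :: nat) = \<one>\<^bsub>G\<^esub>" if "x \<in> carrier G" for x
      using s that unfolding Suc by blast
    have oe: "ord e = 2 ^ Suc m" by (rule ord_eq_power_2[OF e(1) exp[OF e(1)] e(2)])
    obtain H where comp: "cyclic_complement e H"
      using cyclic_complement_exists[OF less.prems(2) exp e(1) oe] by blast
    interpret H: subgroup H G using comp by (simp add: cyclic_complement_def)
    have GH: "comm_group (G\<lparr>carrier := H\<rparr>)"
      by (rule subgroup_comm_group[OF H.subgroup_axioms])
    have pow: "x [^]\<^bsub>G\<lparr>carrier := H\<rparr>\<^esub> n = x [^]\<^bsub>G\<^esub> n" for x and n :: nat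
      by (simp add: nat_pow_def)
    have "e \<notin> H"
    proof
      assume "e \<in> H"
      then have "e [^]\<^bsub>G\<^esub> (1::nat) \<in> H" using e(1) by simp
      then have "e [^]\<^bsub>G\<^esub> (1::nat) = \<one>\<^bsub>G\<^esub>" using comp unfolding cyclic_complement_def by blast
      then show False using e by simp
    qed
    then have "H \<subset> carrier G" using e(1) H.subset by blast
    then have "card (carrier (G\<lparr>carrier := H\<rparr>)) < card (carrier G)"
      using less.prems(2) by (simp add: psubset_card_mono)
    then obtain r t where rt: "\<forall>i\<in>{1..r}. t i \<ge> 1" "strict_mono_on {1..r} t"
      "G\<lparr>carrier := H\<rparr> \<cong> cyclic_2_sum r t"
      using less.hyps[OF _ GH _ three_free_complement[OF less.prems(2,3) comp]] less.prems(2,4)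
        finite_subset[OF H.subset] pow by auto
    then obtain \<psi> where \<psi>: "\<psi> \<in> iso (G\<lparr>carrier := H\<rparr>) (cyclic_2_sum r t)" unfolding is_iso_def by blast
    interpret C: cyclic_2_coordinates "G\<lparr>carrier := H\<rparr>" r t \<psi>
      using \<psi> GH by (simp add: cyclic_2_coordinates_def cyclic_2_coordinates_axioms_def)
    have low: "t i \<le> m" if "i \<in> {1..r}" for i
    proof (rule C.coord_exponent_le[OF _ that])
      fix x assume "x \<in> carrier (G\<lparr>carrier := H\<rparr>)"
      then show "x [^]\<^bsub>G\<lparr>carrier := H\<rparr>\<^esub> (2 ^ m :: nat) = \<one>\<^bsub>G\<lparr>carrier := H\<rparr>\<^esub>"
        unfolding pow using three_free_complement_exponent[OF less.prems(2,3) exp comp oe] by simp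
    qed
    let ?t = "t(Suc r := Suc m)"
    have "G \<cong> cyclic_2_sum (Suc r) ?t"
      by (rule split_off_max_cyclic[OF less.prems(2) comp oe _ \<psi>]) simp
    moreover have "\<forall>i\<in>{1..Suc r}. ?t i \<ge> 1" using rt(1) by simp
    moreover have "strict_mono_on {1..Suc r} ?t"
    proof (rule strict_mono_onI)
      fix i j assume ij: "i \<in> {1..Suc r}" "j \<in> {1..Suc r}" "i < j"
      show "?t i < ?t j"
      proof (cases "j = Suc r")
        case True
        then show ?thesis using low[of i] ij by simp
      next
        case False
        then show ?thesis using strict_mono_onD[OF rt(2), of i j] ij by simp
      qed
    qed
    ultimately show ?thesis by blast
  qed
qed

lemma (in signed_weights) seminormal_imp_three_free:
  assumes "seq_seminormal G B" "\<Gamma> = auto G" shows three_free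
  unfolding three_free_def
proof (intro ballI impI)
  fix \<alpha> \<beta> \<gamma> g assume w: "\<alpha> \<in> auto G" "\<beta> \<in> auto G" "\<gamma> \<in> auto G" and g: "g \<in> carrier G"
    and eq: "\<alpha> g \<otimes> (\<beta> g \<otimes> \<gamma> g) = \<one>"
  have single: "weighted_sum G \<Gamma> {#g#} (\<delta> g)" if "\<delta> \<in> auto G" for \<delta>
    unfolding weighted_sum_single using that g assms(2) by blast
  have "weighted_sum G \<Gamma> ({#g#} + ({#g#} + {#g#})) (\<alpha> g \<otimes> (\<beta> g \<otimes> \<gamma> g))"
    unfolding weighted_sum_union using single w by blast
  then have "weighted_sum G \<Gamma> (replicate_mset 3 g) \<one>" unfolding eq by (simp add: numeral_3_eq_3)
  then show "g = \<one>" by (rule seminormal_cancel_odd[OF assms(1) g, rotated]) simp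
qed

lemma group_exp_of_seminormal:
  assumes "signed_weights G \<Gamma>" "finite (carrier G)" "seq_seminormal G (weighted_zero_sum G \<Gamma>)"
  shows "\<exists>k. group_exp G = 2 ^ k"
proof -
  interpret signed_weights G \<Gamma> by fact
  show ?thesis by (rule group_exp_power_2[OF assms(2) seminormal_imp_ord_power_2[OF assms(2,3)]])
qed

theorem theorem5p3:
  fixes G :: "('a, 'b) monoid_scheme" and \<Gamma> :: "('a \<Rightarrow> 'a) set"
  assumes "comm_group G" and "finite (carrier G)" and "card (carrier G) > 1"
    and "\<Gamma> \<subseteq> auto G" and "plus_minus_id G \<subseteq> \<Gamma>"
  shows
    "(seq_seminormal G (weighted_zero_sum G \<Gamma>) \<longrightarrow> (\<exists>k::nat. group_exp G = 2 ^ k)) \<and>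
     (seq_seminormal G (plus_minus_zero_sum G) \<longleftrightarrow> group_exp G dvd 4) \<and>
     (seq_seminormal G (plus_minus_zero_sum G) \<longrightarrow>
        seq_closure G (plus_minus_zero_sum G) =
        frag_of_mset ` {S \<in> free_abelian_monoid G. seq_sum G S \<in> double_set G}) \<and>
     (seq_seminormal G (weighted_zero_sum G (auto G)) \<longleftrightarrow>
        (\<exists>(r::nat) (t::nat \<Rightarrow> nat). r \<ge> 1 \<and> (\<forall>i\<in>{1..r}. t i \<ge> 1) \<and> strict_mono_on {1..r} t \<and>
           G \<cong> cyclic_2_sum r t)) \<and>
     (\<forall>(r::nat) (t::nat \<Rightarrow> nat).
        r \<ge> 1 \<and> (\<forall>i\<in>{1..r}. t i \<ge> 1) \<and> strict_mono_on {1..r} t \<and> G \<cong> cyclic_2_sum r t \<longrightarrow>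
        seq_closure G (weighted_zero_sum G (auto G)) =
        frag_of_mset ` {S \<in> free_abelian_monoid G. even (num_of_order G (2 ^ t r) S)})"
proof -
  interpret comm_group G by fact
  interpret PM: plus_minus G by unfold_locales
  have weights: "signed_weights G \<Gamma>"
    using assms(4,5) by (simp add: signed_weights_def signed_weights_axioms_def comm_group_axioms)
  have autos: "signed_weights G (auto G)"
    using plus_minus_id_auto[OF comm_group_axioms]
    by (simp add: signed_weights_def signed_weights_axioms_def comm_group_axioms)
  have coords: "\<exists>\<phi>. strict_2_coordinates G r t \<phi>"
    if "r \<ge> 1 \<and> (\<forall>i\<in>{1..r}. t i \<ge> 1) \<and> strict_mono_on {1..r} t \<and> G \<cong> cyclic_2_sum r t" for r t
    using that assms(2) comm_group_axioms
    by (auto simp: strict_2_coordinates_def cyclic_2_coordinates_def is_iso_def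
        cyclic_2_coordinates_axioms_def strict_2_coordinates_axioms_def)
  have 1: "seq_seminormal G (weighted_zero_sum G \<Gamma>) \<longrightarrow> (\<exists>k::nat. group_exp G = 2 ^ k)"
    using group_exp_of_seminormal[OF weights assms(2)] by blast
  have 2: "seq_seminormal G (plus_minus_zero_sum G) \<longleftrightarrow> group_exp G dvd 4"
    unfolding PM.seminormal_plus_minus group_exp_dvd_iff ..
  have 3: "\<exists>r t. r \<ge> 1 \<and> (\<forall>i\<in>{1..r}. t i \<ge> 1) \<and> strict_mono_on {1..r} t \<and> G \<cong> cyclic_2_sum r t"
    if sn: "seq_seminormal G (weighted_zero_sum G (auto G))"
  proof -
    obtain k where "group_exp G = 2 ^ k" using group_exp_of_seminormal[OF autos assms(2) sn] ..
    then have exp: "x [^]\<^bsub>G\<^esub> (2 ^ k :: nat) = \<one>\<^bsub>G\<^esub>" if "x \<in> carrier G" for x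
      using group_exp_dvd_iff[of "2 ^ k"] that by simp
    have "three_free" by (rule signed_weights.seminormal_imp_three_free[OF autos sn refl])
    then obtain r and t :: "nat \<Rightarrow> nat" where rt: "\<forall>i\<in>{1..r}. t i \<ge> 1" "strict_mono_on {1..r} t" "G \<cong> cyclic_2_sum r t"
      using three_free_imp_cyclic_2_sum[OF comm_group_axioms assms(2) _ exp] by blast
    have "r \<noteq> 0"
    proof
      assume "r = 0"
      then have "card (carrier G) = 1"
        using rt(3) card_cyclic_2_sum_0 by (auto simp: is_iso_def iso_def dest: bij_betw_same_card)
      with assms(3) show False by simp
    qed
    then have "r \<ge> 1" by simp
    with rt show ?thesis by blast
  qed
  have 4: "seq_seminormal G (weighted_zero_sum G (auto G))"
    if rt: "r \<ge> 1 \<and> (\<forall>i\<in>{1..r}. t i \<ge> 1) \<and> strict_mono_on {1..r} t \<and> G \<cong> cyclic_2_sum r t" for r t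
  proof -
    obtain \<phi> where "strict_2_coordinates G r t \<phi>" using coords[OF rt] ..
    then show ?thesis by (rule strict_2_coordinates.seminormal_auto)
  qed
  have 5: "\<forall>(r::nat) (t::nat \<Rightarrow> nat).
        r \<ge> 1 \<and> (\<forall>i\<in>{1..r}. t i \<ge> 1) \<and> strict_mono_on {1..r} t \<and> G \<cong> cyclic_2_sum r t \<longrightarrow>
        seq_closure G (weighted_zero_sum G (auto G)) =
        frag_of_mset ` {S \<in> free_abelian_monoid G. even (num_of_order G (2 ^ t r) S)}"
  proof (intro allI impI)
    fix r :: nat and t :: "nat \<Rightarrow> nat"
    assume rt: "r \<ge> 1 \<and> (\<forall>i\<in>{1..r}. t i \<ge> 1) \<and> strict_mono_on {1..r} t \<and> G \<cong> cyclic_2_sum r t"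
    obtain \<phi> where "strict_2_coordinates G r t \<phi>" using coords[OF rt] ..
    then show "seq_closure G (weighted_zero_sum G (auto G)) =
        frag_of_mset ` {S \<in> free_abelian_monoid G. even (num_of_order G (2 ^ t r) S)}"
      by (rule strict_2_coordinates.closure_auto)
  qed
  have 34: "seq_seminormal G (weighted_zero_sum G (auto G)) \<longleftrightarrow>
        (\<exists>(r::nat) (t::nat \<Rightarrow> nat). r \<ge> 1 \<and> (\<forall>i\<in>{1..r}. t i \<ge> 1) \<and> strict_mono_on {1..r} t \<and>
           G \<cong> cyclic_2_sum r t)"
    by (rule iffI, erule 3, elim exE, erule 4)
  show ?thesis
    by (intro conjI 1 2 34 impI[OF PM.closure_plus_minus] 5)
qed

end
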